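(* Let $S\in\mathcal{S}^p$ for $1\le p<\infty$ and $\mu\in M(\mathbb{R}^{2d})$. Then $$\big\langle(\mu\star S)\psi,\phi\big\rangle=\int_{\mathbb{R}^{2d}}\big\langle\pi(z)S\pi(z)^*\psi,\phi\big\rangle\,d\mu(z)\qquad\text{for all }\psi,\phi\in L^2(\mathbb{R}^d).$$
   Context: For $z=(x,\omega)\in\mathbb{R}^{2d}$, $\pi(z)\psi(t)=e^{2\pi i\omega\cdot t}\psi(t-x)$ on $L^2(\mathbb{R}^d)$. $\mathcal{S}^p$, $1\le p<\infty$, is the Schatten $p$-class on $L^2(\mathbb{R}^d)$ and $\mathcal{S}^\infty=\mathcal{L}(L^2(\mathbb{R}^d))$. $M(\mathbb{R}^{2d})$ is the space of bounded complex measures with total variation norm. The measure-operator convolution $\mu\star T$ of $\mu\in M(\mathbb{R}^{2d})$ and $T\in\mathcal{S}^\infty$ (hence for $T$ in any $\mathcal{S}^p$) is the bounded operator defined by duality: $\langle\mu\star T,R\rangle_{\mathcal{S}^\infty,\mathcal{S}^1}=\langle\mu,R\star\check T^*\rangle_{M,C_b}$ for all $R\in\mathcal{S}^1$, where $\langle A,B\rangle_{\mathcal{S}^\infty,\mathcal{S}^1}=\operatorname{tr}(AB^* )$, $\langle\mu,F\rangle_{M,C_b}=\int\overline{F}\,d\mu$, $\check T=PTP$ with $P\psi(t)=\psi(-t)$, and $A\star B(z)=\operatorname{tr}(A\,\pi(z)\check B\pi(z)^* )$. For $T\in\mathcal{S}^1$ it agrees with the extension to measures of the action $\delta_z\star T=\pi(z)T\pi(z)^*$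 making $\mathcal{S}^1$ a Banach module over $M(\mathbb{R}^{2d})$ (and an essential module over $L^1(\mathbb{R}^{2d})$). One has $\|\mu\star T\|_{\mathcal{S}^p}\le\|\mu\|_M\|T\|_{\mathcal{S}^p}$. *)

theory Defs
  imports "HOL-Analysis.Analysis"
begin

section \<open>The Hilbert space of square-integrable functions\<close>

definition sq_integrable :: "('a::euclidean_space \<Rightarrow> complex) \<Rightarrow> bool" where
  "sq_integrable f \<longleftrightarrow>
     f \<in> borel_measurable lborel \<and> integrable lborel (\<lambda>t. (cmod (f t))\<^sup>2)"

lemma sq_integrable_zero: "sq_integrable (\<lambda>_. 0)"
  by (simp add: sq_integrable_def)

lemma sq_integrable_scale: "sq_integrable f \<Longrightarrow> sq_integrable (\<lambda>t. c * f t)"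
  by (auto simp: sq_integrable_def norm_mult power_mult_distrib)

lemma sq_integrable_add:
  assumes "sq_integrable f" "sq_integrable g"
  shows "sq_integrable (\<lambda>t. f t + g t)"
proof -
  have [measurable]: "f \<in> borel_measurable borel" "g \<in> borel_measurable borel"
    using assms by (auto simp: sq_integrable_def)
  have "integrable lborel (\<lambda>t. (cmod (f t + g t))\<^sup>2)"
  proof (rule Bochner_Integration.integrable_bound)
    show "integrable lborel (\<lambda>t. 2 * (cmod (f t))\<^sup>2 + 2 * (cmod (g t))\<^sup>2)"
      using assms by (auto simp: sq_integrable_def)
    have "(cmod (a + b))\<^sup>2 \<le> 2 * (cmod a)\<^sup>2 + 2 * (cmod b)\<^sup>2" for a b
    proof -
      have "(cmod (a + b))\<^sup>2 \<le> (cmod a + cmod b)\<^sup>2"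
        by (intro power_mono norm_triangle_ineq) auto
      also have "\<dots> \<le> 2 * (cmod a)\<^sup>2 + 2 * (cmod b)\<^sup>2"
        using zero_le_power2[of "cmod a - cmod b"]
        by (simp add: power2_sum power2_diff)
      finally show ?thesis .
    qed
    then show "AE t in lborel. norm ((cmod (f t + g t))\<^sup>2)
        \<le> norm (2 * (cmod (f t))\<^sup>2 + 2 * (cmod (g t))\<^sup>2)"
      by (intro AE_I2) (simp add: abs_of_nonneg)
  qed measurable
  then show ?thesis
    by (simp add: sq_integrable_def)
qed

lemma borel_measurable_cnj [measurable (raw)]:
  "f \<in> borel_measurable M \<Longrightarrow> (\<lambda>x. cnj (f x)) \<in> borel_measurable M"
  by (rule borel_measurable_continuous_on[where f = cnj]) (intro continuous_intros)

lemma sq_integrable_prod: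
  assumes "sq_integrable f" "sq_integrable g"
  shows "integrable lborel (\<lambda>t. f t * cnj (g t))"
proof (rule Bochner_Integration.integrable_bound)
  have [measurable]: "f \<in> borel_measurable borel" "g \<in> borel_measurable borel"
    using assms by (auto simp: sq_integrable_def)
  show "integrable lborel (\<lambda>t. (cmod (f t))\<^sup>2 + (cmod (g t))\<^sup>2)"
    using assms by (auto simp: sq_integrable_def)
  show "(\<lambda>t. f t * cnj (g t)) \<in> borel_measurable lborel"
    by measurable
  have "cmod a * cmod b \<le> (cmod a)\<^sup>2 + (cmod b)\<^sup>2" for a b
  proof -
    have "0 \<le> cmod a * cmod b"
      by simp
    then show ?thesis
      using zero_le_power2[of "cmod a - cmod b"] unfolding power2_diff by linarith
  qed
  then show "AE t in lborel. norm (f t * cnj (g t)) \<le> norm ((cmod (f t))\<^sup>2 + (cmod (g t))\<^sup>2)"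
    by (intro AE_I2) (simp add: norm_mult abs_of_nonneg)
qed

definition l2_rel :: "('a::euclidean_space \<Rightarrow> complex) \<Rightarrow> ('a \<Rightarrow> complex) \<Rightarrow> bool" where
  "l2_rel f g \<longleftrightarrow> sq_integrable f \<and> sq_integrable g \<and> (AE t in lborel. f t = g t)"

lemma part_equivp_l2_rel: "part_equivp l2_rel"
proof (rule part_equivpI)
  show "\<exists>f::'a::euclidean_space \<Rightarrow> complex. l2_rel f f"
    by (rule exI[of _ "\<lambda>_. 0"]) (simp add: l2_rel_def sq_integrable_zero)
  show "symp (l2_rel :: ('a \<Rightarrow> complex) \<Rightarrow> _)"
    by (auto simp: symp_def l2_rel_def elim: eventually_mono)
  show "transp (l2_rel :: ('a \<Rightarrow> complex) \<Rightarrow> _)"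
    by (auto simp: transp_def l2_rel_def elim: eventually_elim2)
qed

quotient_type (overloaded) 'a l2 = "'a::euclidean_space \<Rightarrow> complex" / partial: l2_rel
  by (rule part_equivp_l2_rel)

text \<open>Inner products are linear in the first and antilinear in the second argument.\<close>

lift_definition cinner :: "'a::euclidean_space l2 \<Rightarrow> 'a l2 \<Rightarrow> complex"
  is "\<lambda>f g. \<integral>t. f t * cnj (g t) \<partial>lborel"
proof -
  fix f f' g g' :: "'a \<Rightarrow> complex"
  assume f: "l2_rel f f'" and g: "l2_rel g g'"
  then have [measurable]: "f \<in> borel_measurable borel" "g \<in> borel_measurable borel"
    "f' \<in> borel_measurable borel" "g' \<in> borel_measurable borel"
    by (auto simp: l2_rel_def sq_integrable_def)
  from f g have "AE t in lborel. f t = f' t" "AE t in lborel. g t = g' t"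
    by (auto simp: l2_rel_def)
  then show "(\<integral>t. f t * cnj (g t) \<partial>lborel) = (\<integral>t. f' t * cnj (g' t) \<partial>lborel)"
    by (intro integral_cong_AE) (auto elim: eventually_elim2)
qed

lift_definition scaleC :: "complex \<Rightarrow> 'a::euclidean_space l2 \<Rightarrow> 'a l2"
  is "\<lambda>c f t. c * f t"
  by (auto simp: l2_rel_def intro: sq_integrable_scale)

instantiation l2 :: (euclidean_space) real_vector
begin

lift_definition zero_l2 :: "'a l2" is "\<lambda>_. 0"
  by (simp add: l2_rel_def sq_integrable_zero)

lift_definition plus_l2 :: "'a l2 \<Rightarrow> 'a l2 \<Rightarrow> 'a l2" is "\<lambda>f g t. f t + g t"
  by (auto simp: l2_rel_def intro: sq_integrable_add elim: eventually_elim2)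

lift_definition uminus_l2 :: "'a l2 \<Rightarrow> 'a l2" is "\<lambda>f t. - f t"
  by (auto simp: l2_rel_def sq_integrable_def)

definition minus_l2 :: "'a l2 \<Rightarrow> 'a l2 \<Rightarrow> 'a l2" where
  "minus_l2 x y = x + - y"

definition scaleR_l2 :: "real \<Rightarrow> 'a l2 \<Rightarrow> 'a l2" where
  "scaleR_l2 r x = scaleC (complex_of_real r) x"

lemma scaleC_simps:
  "scaleC a (x + y) = scaleC a x + scaleC a y"
  "scaleC (a + b) x = scaleC a x + scaleC b x"
  "scaleC a (scaleC b x) = scaleC (a * b) x"
  "scaleC 1 x = x" for x y :: "'a l2"
  by (transfer; auto simp: l2_rel_def algebra_simps
        intro!: sq_integrable_scale sq_integrable_add)+

instance
proof
  fix x y z :: "'a l2" and r s :: real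
  show "x + y + z = x + (y + z)"
    by transfer (auto simp: l2_rel_def add.assoc intro!: sq_integrable_add)
  show "x + y = y + x"
    by transfer (auto simp: l2_rel_def add.commute intro!: sq_integrable_add)
  show "0 + x = x"
    by transfer (auto simp: l2_rel_def)
  show "- x + x = 0"
    by transfer (auto simp: l2_rel_def sq_integrable_zero)
  show "x - y = x + - y"
    by (rule minus_l2_def)
  show "r *\<^sub>R (x + y) = r *\<^sub>R x + r *\<^sub>R y" "(r + s) *\<^sub>R x = r *\<^sub>R x + s *\<^sub>R x"
    "r *\<^sub>R s *\<^sub>R x = (r * s) *\<^sub>R x" "1 *\<^sub>R x = x"
    by (simp_all add: scaleR_l2_def scaleC_simps)
qed

end

lemma cinner_add_left: "cinner (x + y) z = cinner x z + cinner y z" for x y z :: "'a::euclidean_space l2"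
  by transfer (simp add: l2_rel_def distrib_right sq_integrable_prod)

lemma cinner_scaleC_left: "cinner (scaleC c x) y = c * cinner x y" for x y :: "'a::euclidean_space l2"
  by transfer (simp add: mult.assoc)

lemma cinner_commute: "cinner x y = cnj (cinner y x)" for x y :: "'a::euclidean_space l2"
proof transfer
  fix f g :: "'a \<Rightarrow> complex"
  have "cnj (\<integral>t. g t * cnj (f t) \<partial>lborel) = (\<integral>t. cnj (g t * cnj (f t)) \<partial>lborel)"
    by (rule Bochner_Integration.integral_cnj[symmetric])
  then show "(\<integral>t. f t * cnj (g t) \<partial>lborel) = cnj (\<integral>t. g t * cnj (f t) \<partial>lborel)"
    by (simp add: mult.commute)
qed

lemma cinner_self: "cinner x x = complex_of_real (Re (cinner x x)) \<and> 0 \<le> Re (cinner x x)"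
  for x :: "'a::euclidean_space l2"
proof transfer
  fix f :: "'a \<Rightarrow> complex"
  have *: "f t * cnj (f t) = complex_of_real ((cmod (f t))\<^sup>2)" for t
    by (rule complex_norm_square[symmetric])
  show "(\<integral>t. f t * cnj (f t) \<partial>lborel) = complex_of_real (Re (\<integral>t. f t * cnj (f t) \<partial>lborel)) \<and>
    0 \<le> Re (\<integral>t. f t * cnj (f t) \<partial>lborel)"
    unfolding * integral_complex_of_real by simp
qed

lemma cinner_self_eq_0: "Re (cinner x x) = 0 \<longleftrightarrow> x = 0" for x :: "'a::euclidean_space l2"
proof transfer
  fix f :: "'a \<Rightarrow> complex"
  assume f: "l2_rel f f"
  then have int: "integrable lborel (\<lambda>t. (cmod (f t))\<^sup>2)"
    by (simp add: l2_rel_def sq_integrable_def)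
  have *: "f t * cnj (f t) = complex_of_real ((cmod (f t))\<^sup>2)" for t
    by (rule complex_norm_square[symmetric])
  have "Re (\<integral>t. f t * cnj (f t) \<partial>lborel) = (\<integral>t. (cmod (f t))\<^sup>2 \<partial>lborel)"
    unfolding * integral_complex_of_real by simp
  also have "\<dots> = 0 \<longleftrightarrow> (AE t in lborel. (cmod (f t))\<^sup>2 = 0)"
    using int by (intro integral_nonneg_eq_0_iff_AE) auto
  also have "\<dots> \<longleftrightarrow> l2_rel f (\<lambda>_. 0)"
    using f by (simp add: l2_rel_def sq_integrable_zero)
  finally show "Re (\<integral>t. f t * cnj (f t) \<partial>lborel) = 0 \<longleftrightarrow> l2_rel f (\<lambda>_. 0)" .
qed

instantiation l2 :: (euclidean_space) real_inner
begin

definition inner_l2 :: "'a l2 \<Rightarrow> 'a l2 \<Rightarrow> real" where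
  "inner_l2 x y = Re (cinner x y)"

definition norm_l2 :: "'a l2 \<Rightarrow> real" where
  "norm_l2 x = sqrt (inner x x)"

definition sgn_l2 :: "'a l2 \<Rightarrow> 'a l2" where
  "sgn_l2 x = x /\<^sub>R norm x"

definition dist_l2 :: "'a l2 \<Rightarrow> 'a l2 \<Rightarrow> real" where
  "dist_l2 x y = norm (x - y)"

definition uniformity_l2 :: "('a l2 \<times> 'a l2) filter" where
  "uniformity_l2 = (INF e\<in>{0<..}. principal {(x, y). dist x y < e})"

definition open_l2 :: "'a l2 set \<Rightarrow> bool" where
  "open_l2 U \<longleftrightarrow> (\<forall>x\<in>U. \<forall>\<^sub>F (x', y) in uniformity. x' = x \<longrightarrow> y \<in> U)"

instance
proof
  fix x y z :: "'a l2" and r :: real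
  show "sgn x = x /\<^sub>R norm x" "dist x y = norm (x - y)" "norm x = sqrt (inner x x)"
    by (simp_all add: sgn_l2_def dist_l2_def norm_l2_def)
  show "(uniformity :: ('a l2 \<times> 'a l2) filter) = (INF e\<in>{0<..}. principal {(x, y). dist x y < e})"
    by (rule uniformity_l2_def)
  show "open U \<longleftrightarrow> (\<forall>x\<in>U. \<forall>\<^sub>F (x', y) in uniformity. x' = x \<longrightarrow> y \<in> U)" for U :: "'a l2 set"
    by (rule open_l2_def)
  show "inner x y = inner y x"
    unfolding inner_l2_def by (subst cinner_commute) simp
  show "inner (x + y) z = inner x z + inner y z"
    by (simp add: inner_l2_def cinner_add_left)
  show "inner (r *\<^sub>R x) y = r * inner x y"
    by (simp add: inner_l2_def scaleR_l2_def cinner_scaleC_left)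
  show "0 \<le> inner x x" "inner x x = 0 \<longleftrightarrow> x = 0"
    using cinner_self[of x] by (simp_all add: inner_l2_def cinner_self_eq_0)
qed

end

section \<open>Time-frequency shifts and parity\<close>

lemma lborel_distr_affine_unit:
  fixes a :: "'a::euclidean_space"
  assumes "\<bar>c\<bar> = 1"
  shows "distr lborel borel (\<lambda>t. a + c *\<^sub>R t) = lborel"
proof -
  have "c \<noteq> 0" using assms by auto
  from lborel_affine[OF this, of a] assms show ?thesis
    by (simp add: density_1)
qed

lemma l2_rel_affine_unit:
  fixes a :: "'a::euclidean_space"
  assumes "l2_rel f g" and c: "\<bar>c\<bar> = 1"
  shows "l2_rel (\<lambda>t. f (a + c *\<^sub>R t)) (\<lambda>t. g (a + c *\<^sub>R t))"
proof -
  have aff[measurable]: "(\<lambda>t. a + c *\<^sub>R t) \<in> borel_measurable borel"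
    by measurable
  have sq: "sq_integrable (\<lambda>t. h (a + c *\<^sub>R t))" if "sq_integrable h" for h
  proof -
    have [measurable]: "h \<in> borel_measurable borel"
      using that by (simp add: sq_integrable_def)
    have "integrable (distr lborel borel (\<lambda>t. a + c *\<^sub>R t)) (\<lambda>t. (cmod (h t))\<^sup>2)"
      using that by (simp add: lborel_distr_affine_unit[OF c] sq_integrable_def)
    then show ?thesis
      by (subst (asm) integrable_distr_eq) (auto simp: sq_integrable_def)
  qed
  have [measurable]: "f \<in> borel_measurable borel" "g \<in> borel_measurable borel"
    using assms by (auto simp: l2_rel_def sq_integrable_def)
  have "AE t in distr lborel borel (\<lambda>t. a + c *\<^sub>R t). f t = g t"
    using assms(1) unfolding lborel_distr_affine_unit[OF c] l2_rel_def by blast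
  then have "AE t in lborel. f (a + c *\<^sub>R t) = g (a + c *\<^sub>R t)"
    by (subst (asm) AE_distr_iff) auto
  with sq assms show ?thesis
    by (auto simp: l2_rel_def)
qed

text \<open>Points of phase space are pairs \<open>z = (x, \<omega>)\<close> of position and frequency.\<close>

lift_definition tf_shift :: "'a::euclidean_space \<times> 'a \<Rightarrow> 'a l2 \<Rightarrow> 'a l2"
  is "\<lambda>(x, \<omega>) \<psi> t. exp (2 * of_real pi * \<i> * of_real (\<omega> \<bullet> t)) * \<psi> (t - x)"
proof -
  fix z :: "'a \<times> 'a" and f g :: "'a \<Rightarrow> complex"
  assume fg: "l2_rel f g"
  obtain x \<omega> where z: "z = (x, \<omega>)" by fastforce
  let ?e = "\<lambda>t. exp (2 * of_real pi * \<i> * of_real (\<omega> \<bullet> t))"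
  have e: "cmod (?e t) = 1" for t
    by simp
  have sq: "sq_integrable (\<lambda>t. ?e t * h (t - x))"
    if "sq_integrable (\<lambda>t. h (t - x))" for h :: "'a \<Rightarrow> complex"
  proof -
    have [measurable]: "(\<lambda>t. h (t - x)) \<in> borel_measurable borel"
      using that by (simp add: sq_integrable_def)
    have [measurable]: "?e \<in> borel_measurable borel"
      by (intro borel_measurable_continuous_onI continuous_intros)
    have "(\<lambda>t. ?e t * h (t - x)) \<in> borel_measurable borel"
      by measurable
    then show ?thesis
      using that unfolding sq_integrable_def norm_mult e by simp
  qed
  have "l2_rel (\<lambda>t. f (t - x)) (\<lambda>t. g (t - x))"
    using l2_rel_affine_unit[OF fg, of 1 "- x"] by simp
  then show "l2_rel ((case z of (x, \<omega>) \<Rightarrow> \<lambda>\<psi> t. exp (2 * of_real pi * \<i> * of_real (\<omega> \<bullet> t)) * \<psi> (t - x)) f)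
       ((case z of (x, \<omega>) \<Rightarrow> \<lambda>\<psi> t. exp (2 * of_real pi * \<i> * of_real (\<omega> \<bullet> t)) * \<psi> (t - x)) g)"
    by (auto simp: z l2_rel_def intro!: sq)
qed

lift_definition parity :: "'a::euclidean_space l2 \<Rightarrow> 'a l2" is "\<lambda>\<psi> t. \<psi> (- t)"
  using l2_rel_affine_unit[of _ _ "- 1" 0] by simp

section \<open>Operators\<close>

type_synonym 'a op = "'a l2 \<Rightarrow> 'a l2"

definition bounded_op :: "'a::euclidean_space op \<Rightarrow> bool" where
  "bounded_op T \<longleftrightarrow> bounded_linear T \<and> (\<forall>c x. T (scaleC c x) = scaleC c (T x))"

text \<open>Meaningful for bounded operators, for which the adjoint exists and is unique.\<close>

definition adj :: "'a::euclidean_space op \<Rightarrow> 'a op" where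
  "adj T = (THE A. \<forall>x y. cinner (T x) y = cinner x (A y))"

definition check :: "'a::euclidean_space op \<Rightarrow> 'a op" where
  "check T = parity \<circ> T \<circ> parity"

definition orthonormal_seq :: "(nat \<Rightarrow> 'a::euclidean_space l2) \<Rightarrow> bool" where
  "orthonormal_seq e \<longleftrightarrow> (\<forall>m n. cinner (e m) (e n) = (if m = n then 1 else 0))"

text \<open>
  The singular value decomposition \<open>T = \<Sum>n. s n \<langle>\<cdot>, e n\<rangle> f n\<close>, which exists precisely for the
  compact operators. The sequence \<open>s\<close> lists the singular values with multiplicity and may be padded
  with zeros; since the space is infinite-dimensional, the orthonormal systems of a finite-rank
  operator can be continued to infinite ones.
\<close>

definition singular_value_decomp ::
  "'a::euclidean_space op \<Rightarrow> (nat \<Rightarrow> real) \<Rightarrow> (nat \<Rightarrow> 'a l2) \<Rightarrow> (nat \<Rightarrow> 'a l2) \<Rightarrow> bool" where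
  "singular_value_decomp T s e f \<longleftrightarrow>
     (\<forall>n. 0 \<le> s n) \<and> s \<longlonglongrightarrow> 0 \<and> orthonormal_seq e \<and> orthonormal_seq f \<and>
     (\<forall>\<psi>. (\<lambda>n. scaleC (of_real (s n) * cinner \<psi> (e n)) (f n)) sums T \<psi>)"

text \<open>The Schatten class for a finite exponent \<open>p \<ge> 1\<close>.\<close>

definition schatten :: "real \<Rightarrow> 'a::euclidean_space op set" where
  "schatten p = {T. \<exists>s e f. singular_value_decomp T s e f \<and> summable (\<lambda>n. s n powr p)}"

definition orthonormal_basis :: "'a::euclidean_space l2 set \<Rightarrow> bool" where
  "orthonormal_basis E \<longleftrightarrow>
     (\<forall>x\<in>E. \<forall>y\<in>E. cinner x y = (if x = y then 1 else 0)) \<and>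
     (\<forall>x. (\<forall>e\<in>E. cinner x e = 0) \<longrightarrow> x = 0)"

text \<open>Meaningful for trace class operators: the sum does not depend on the basis.\<close>

definition op_trace :: "'a::euclidean_space op \<Rightarrow> complex" where
  "op_trace T = (THE t. \<forall>E. orthonormal_basis E \<longrightarrow> ((\<lambda>e. cinner (T e) e) has_sum t) E)"

definition op_conv :: "'a::euclidean_space op \<Rightarrow> 'a op \<Rightarrow> 'a \<times> 'a \<Rightarrow> complex" where
  "op_conv A B z = op_trace (A \<circ> tf_shift z \<circ> check B \<circ> adj (tf_shift z))"

section \<open>Complex measures\<close>

text \<open>
  Complex Borel measures as countably additive set functions. Being complex-valued, such a function
  automatically has finite total variation; its values off the Borel sets are irrelevant.
\<close>

definition complex_measure :: "('z::topological_space set \<Rightarrow> complex) \<Rightarrow> bool" where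
  "complex_measure \<mu> \<longleftrightarrow>
     (\<forall>A :: nat \<Rightarrow> 'z set. range A \<subseteq> sets borel \<longrightarrow> disjoint_family A \<longrightarrow>
        (\<lambda>n. \<mu> (A n)) sums \<mu> (\<Union>n. A n))"

text \<open>
  The polar decomposition \<open>d\<mu> = h d\<nu>\<close> with \<open>\<bar>h\<bar> = 1\<close>. It forces \<open>\<nu>\<close> to be the total variation
  measure of \<open>\<mu>\<close> and determines \<open>h\<close> almost everywhere, so the choice made in the integral below is
  immaterial.
\<close>

definition polar_decomp ::
  "('z::topological_space set \<Rightarrow> complex) \<Rightarrow> 'z measure \<Rightarrow> ('z \<Rightarrow> complex) \<Rightarrow> bool" where
  "polar_decomp \<mu> \<nu> h \<longleftrightarrow>
     finite_measure \<nu> \<and> sets \<nu> = sets borel \<and> h \<in> borel_measurable borel \<and>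
     (\<forall>z. cmod (h z) = 1) \<and> (\<forall>A\<in>sets borel. \<mu> A = (\<integral>z\<in>A. h z \<partial>\<nu>))"

definition cm_integral ::
  "('z::topological_space set \<Rightarrow> complex) \<Rightarrow> ('z \<Rightarrow> complex) \<Rightarrow> complex" where
  "cm_integral \<mu> F =
     (case SOME (\<nu>, h). polar_decomp \<mu> \<nu> h of (\<nu>, h) \<Rightarrow> \<integral>z. F z * h z \<partial>\<nu>)"

text \<open>
  The convolution of a measure with a bounded operator, defined by
  \<open>\<langle>\<mu> \<star> T, R\<rangle> = \<langle>\<mu>, R \<star> (check T)\<^sup>*\<rangle>\<close> for all trace class \<open>R\<close>, with the pairings
  \<open>\<langle>A, R\<rangle> = tr (A R\<^sup>*)\<close> and \<open>\<langle>\<mu>, F\<rangle> = \<integral> cnj F d\<mu>\<close>.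
\<close>

definition measure_conv :: "(('a::euclidean_space \<times> 'a) set \<Rightarrow> complex) \<Rightarrow> 'a op \<Rightarrow> 'a op" where
  "measure_conv \<mu> T =
     (THE B. bounded_op B \<and>
        (\<forall>R\<in>schatten 1.
           op_trace (B \<circ> adj R) = cm_integral \<mu> (\<lambda>z. cnj (op_conv R (adj (check T)) z))))"

end

theory Submission
  imports Defs
begin

text \<open>
  The convolution \<open>\<mu> \<star> S\<close> is defined as the unique bounded operator \<open>B\<close> with
  \<open>tr (B R\<^sup>*) = \<integral> cnj (tr (R \<pi>(z) S\<^sup>* \<pi>(z)\<^sup>*)) d\<mu>(z)\<close> for all trace class \<open>R\<close>. The asserted formula says that this
  operator is the weak integral of the translates \<open>\<pi>(z) S \<pi>(z)\<^sup>*\<close> of \<open>S\<close>. So the proof constructs the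
  weak integral, verifies that it satisfies the defining relation, and shows that the relation has
  at most one solution.

  Existence of the weak integral: \<open>\<langle>\<pi>(z) S \<pi>(z)\<^sup>* \<psi>, \<phi>\<rangle>\<close> is measurable in \<open>z\<close> and bounded by
  \<open>K * \<parallel>\<psi>\<parallel> * \<parallel>\<phi>\<parallel>\<close>, and \<open>\<mu>\<close> has finite total variation, so integration yields a bounded sesquilinear
  form, which is represented by a bounded operator (\<open>weak_integral_shift_op\<close>).

  The defining relation: for \<open>R = \<Sum>n. r n \<langle>\<cdot>, a n\<rangle> b n\<close> with summable \<open>r\<close>, both traces are computed from
  Parseval's identity and Fubini's theorem for sums (\<open>op_trace_nuclear\<close>):
  \<open>tr (B R\<^sup>*) = \<Sum>n. r n \<langle>B (a n), b n\<rangle>\<close>, and the conjugate of \<open>tr (R \<pi>(z) S\<^sup>* \<pi>(z)\<^sup>*)\<close> is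
  \<open>\<Sum>n. r n \<langle>\<pi>(z) S \<pi>(z)\<^sup>* (a n), b n\<rangle>\<close>. Integrating the second series term by term gives the first
  (\<open>op_trace_comp_adj_weak_integral\<close>).

  Uniqueness: taking \<open>R\<close> of rank one recovers all matrix elements of \<open>B\<close>
  (\<open>bounded_op_eq_if_traces_eq\<close>).

  Three facts of general theory carry this. The space of square-integrable functions is complete
  (\<open>Cauchy_convergent_l2\<close>), which makes maximal orthonormal sets into bases with Parseval's identity
  and yields the Riesz representation and adjoints. Orthonormal bases exist and are infinite
  (\<open>orthonormal_basis_exists\<close>, \<open>infinite_orthonormal_basis\<close>), so that traces and singular value
  decompositions of rank one operators make sense. Every complex measure has a polar decomposition
  (\<open>polar_decomp_exists\<close>), by Jordan decomposition and Radon--Nikodym, so that integrals against \<open>\<mu>\<close>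
  are integrals against a finite positive measure.
\<close>

section \<open>Inner product and norm of L2\<close>

lemma cinner_add_right: "cinner x (y + z) = cinner x y + cinner x z"
  for x y z :: "'a::euclidean_space l2"
  by (subst (1 2 3) cinner_commute) (simp add: cinner_add_left)

lemma cinner_scaleC_right: "cinner x (scaleC c y) = cnj c * cinner x y"
  for x y :: "'a::euclidean_space l2"
  by (subst (1 2) cinner_commute) (simp add: cinner_scaleC_left)

lemma cinner_scaleR_left: "cinner (r *\<^sub>R x) y = r *\<^sub>R cinner x y"
  for x y :: "'a::euclidean_space l2"
  by (simp add: scaleR_l2_def cinner_scaleC_left scaleR_conv_of_real)

lemma cinner_scaleR_right: "cinner x (r *\<^sub>R y) = r *\<^sub>R cinner x y"
  for x y :: "'a::euclidean_space l2"
  by (simp add: scaleR_l2_def cinner_scaleC_right scaleR_conv_of_real)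

lemma cinner_eq_norm: "cinner x x = of_real ((norm x)\<^sup>2)" for x :: "'a::euclidean_space l2"
  using cinner_self[of x] by (metis inner_l2_def power2_norm_eq_inner)

lemma norm_scaleC: "norm (scaleC c x) = cmod c * norm x" for x :: "'a::euclidean_space l2"
proof -
  have "complex_of_real ((norm (scaleC c x))\<^sup>2) = of_real ((cmod c * norm x)\<^sup>2)"
    unfolding cinner_eq_norm[symmetric] cinner_scaleC_left cinner_scaleC_right
    by (simp add: cinner_eq_norm power_mult_distrib) (metis complex_norm_square mult.commute of_real_power)
  then show ?thesis
    by (simp del: of_real_power) 
qed

text \<open>
  The real inner product only bounds the real part of \<open>cinner\<close>; rotating one argument by a phase
  makes the complex number \<open>cinner x y\<close> real.
\<close>

lemma cinner_Cauchy_Schwarz: "cmod (cinner x y) \<le> norm x * norm y"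
  for x y :: "'a::euclidean_space l2"
proof -
  define u where "u = (if cinner x y = 0 then 1 else cnj (sgn (cinner x y)))"
  have u: "cmod u = 1"
    by (simp add: u_def norm_sgn)
  have "cnj (sgn w) * w = of_real (cmod w)" for w :: complex
    by (cases "w = 0") (auto simp: sgn_eq complex_norm_square[symmetric] power2_eq_square
        field_simps simp flip: of_real_mult)
  then have "u * cinner x y = of_real (cmod (cinner x y))"
    by (simp add: u_def)
  then have "cmod (cinner x y) = inner (scaleC u x) y"
    by (simp add: inner_l2_def cinner_scaleC_left)
  also have "\<dots> \<le> norm (scaleC u x) * norm y"
    by (rule norm_cauchy_schwarz)
  finally show ?thesis
    by (simp add: norm_scaleC u)
qed

lemma bounded_bilinear_cinner:
  "bounded_bilinear (cinner :: 'a::euclidean_space l2 \<Rightarrow> 'a l2 \<Rightarrow> complex)"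
  by standard (auto simp: cinner_add_left cinner_add_right cinner_scaleR_left cinner_scaleR_right
      intro!: exI[of _ 1] cinner_Cauchy_Schwarz)

lemmas bounded_linear_cinner_left = bounded_bilinear.bounded_linear_left[OF bounded_bilinear_cinner]
lemmas bounded_linear_cinner_right = bounded_bilinear.bounded_linear_right[OF bounded_bilinear_cinner]
lemmas cinner_zero_left [simp] = bounded_bilinear.zero_left[OF bounded_bilinear_cinner]
lemmas cinner_zero_right [simp] = bounded_bilinear.zero_right[OF bounded_bilinear_cinner]
lemmas cinner_diff_left = bounded_bilinear.diff_left[OF bounded_bilinear_cinner]
lemmas cinner_diff_right = bounded_bilinear.diff_right[OF bounded_bilinear_cinner]
lemmas cinner_sum_left = bounded_bilinear.sum_left[OF bounded_bilinear_cinner]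
lemmas cinner_sum_right = bounded_bilinear.sum_right[OF bounded_bilinear_cinner]

lemma bounded_linear_scaleC: "bounded_linear (scaleC c :: 'a::euclidean_space l2 \<Rightarrow> 'a l2)"
proof (rule bounded_linear_intro[where K = "cmod c"])
  fix x y :: "'a l2" and r :: real
  show "scaleC c (x + y) = scaleC c x + scaleC c y"
    by (rule scaleC_simps)
  show "scaleC c (r *\<^sub>R x) = r *\<^sub>R scaleC c x"
    by (simp add: scaleR_l2_def scaleC_simps mult.commute)
  show "norm (scaleC c x) \<le> norm x * cmod c"
    by (simp add: norm_scaleC mult.commute)
qed

lemma cinner_eqI: "(\<And>y. cinner x y = cinner x' y) \<Longrightarrow> x = x'" for x x' :: "'a::euclidean_space l2"
  by (metis cinner_diff_left cinner_self_eq_0 eq_iff_diff_eq_0 zero_complex.sel(1))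

section \<open>Completeness of L2\<close>

lemma l2_representative:
  fixes x :: "'a::euclidean_space l2"
  obtains f where "sq_integrable f" "x = abs_l2 f"
proof -
  have "l2_rel (rep_l2 x) (rep_l2 x)" "abs_l2 (rep_l2 x) = x"
    using Quotient_l2 unfolding Quotient_def by auto
  then show ?thesis
    using that[of "rep_l2 x"] by (auto simp: l2_rel_def)
qed

lemma l2_rel_refl: "sq_integrable f \<Longrightarrow> l2_rel f f"
  by (simp add: l2_rel_def)

lemma sq_integrable_diff: "sq_integrable f \<Longrightarrow> sq_integrable g \<Longrightarrow> sq_integrable (\<lambda>t. f t - g t)"
  using sq_integrable_add[of f "\<lambda>t. - 1 * g t"] sq_integrable_scale[of g "- 1"] by simp

lemma nn_integral_eq_norm_l2:
  fixes f :: "'a::euclidean_space \<Rightarrow> complex"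
  assumes "sq_integrable f"
  shows "(\<integral>\<^sup>+t. ennreal ((cmod (f t))\<^sup>2) \<partial>lborel) = ennreal ((norm (abs_l2 f))\<^sup>2)"
proof -
  have *: "f t * cnj (f t) = complex_of_real ((cmod (f t))\<^sup>2)" for t
    by (rule complex_norm_square[symmetric])
  have "cinner (abs_l2 f) (abs_l2 f) = (\<integral>t. f t * cnj (f t) \<partial>lborel)"
    by (intro cinner.abs_eq l2_rel_refl assms)
  then have "(norm (abs_l2 f))\<^sup>2 = (\<integral>t. (cmod (f t))\<^sup>2 \<partial>lborel)"
    unfolding cinner_eq_norm * integral_complex_of_real by (simp del: of_real_power)
  then show ?thesis
    using assms by (subst nn_integral_eq_integral) (auto simp: sq_integrable_def)
qed

lemma abs_l2_diff:
  assumes "sq_integrable f" "sq_integrable g"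
  shows "abs_l2 f - abs_l2 g = abs_l2 (\<lambda>t. f t - g t)"
  using assms unfolding minus_l2_def
  by (simp add: uminus_l2.abs_eq plus_l2.abs_eq l2_rel_refl
      sq_integrable_scale[of g "- 1", simplified])

text \<open>
  Riesz--Fischer. Along a subsequence \<open>r\<close> whose increments \<open>g k\<close> have norm at most \<open>(1/2) ^ k\<close>, the
  weighted square sum \<open>\<Sum>k. 2 ^ k * \<bar>g k t\<bar>\<^sup>2\<close> has finite integral, hence is finite for almost every
  \<open>t\<close>, which bounds \<open>g k t\<close> by a geometric sequence. Working with this sum of squares avoids
  Minkowski's inequality. Fatou's lemma then controls the distance to the pointwise limit.
\<close>

lemma Cauchy_convergent_l2:
  fixes X :: "nat \<Rightarrow> 'a::euclidean_space l2"
  assumes "Cauchy X"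
  shows "convergent X"
proof -
  have "\<exists>N. \<forall>m\<ge>N. \<forall>n\<ge>N. norm (X m - X n) < (1/2) ^ k" for k
    using CauchyD[OF assms, of "(1/2) ^ k"] by auto
  then obtain N where N: "\<And>k m n. m \<ge> N k \<Longrightarrow> n \<ge> N k \<Longrightarrow> norm (X m - X n) < (1/2) ^ k"
    by metis
  \<comment> \<open>Summing makes the indices monotone, so that \<open>r m\<close> is past \<open>N k\<close> for all \<open>m \<ge> k\<close>.\<close>
  define r where "r k = (\<Sum>j\<le>k. N j)" for k
  have r: "N k \<le> r m" if "k \<le> m" for k m
    unfolding r_def using that by (intro member_le_sum) auto
  have "\<exists>f. sq_integrable f \<and> X n = abs_l2 f" for n
    by (metis l2_representative)
  then obtain f where f: "\<And>n. sq_integrable (f n)" "\<And>n. X n = abs_l2 (f n)"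
    by metis
  have [measurable]: "f n \<in> borel_measurable borel" for n
    using f(1)[of n] by (simp add: sq_integrable_def)
  have dist: "(\<integral>\<^sup>+t. ennreal ((cmod (f m t - f n t))\<^sup>2) \<partial>lborel) \<le> ennreal ((1/4) ^ k)"
    if "m \<ge> N k" "n \<ge> N k" for k m n
  proof -
    have "(\<integral>\<^sup>+t. ennreal ((cmod (f m t - f n t))\<^sup>2) \<partial>lborel) = ennreal ((norm (X m - X n))\<^sup>2)"
      by (simp add: nn_integral_eq_norm_l2 sq_integrable_diff f abs_l2_diff)
    also have "\<dots> \<le> ennreal (((1/2) ^ k)\<^sup>2)"
      using N[OF that] by (intro ennreal_leI power_mono) auto
    also have "((1/2::real) ^ k)\<^sup>2 = (1/4) ^ k"
      by (simp add: power2_eq_square flip: power_mult_distrib)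
    finally show ?thesis .
  qed
  define g where "g k t = f (r (Suc k)) t - f (r k) t" for k t
  have [measurable]: "g k \<in> borel_measurable borel" for k
    unfolding g_def by measurable
  define H where "H t = (\<Sum>k. ennreal (2 ^ k * (cmod (g k t))\<^sup>2))" for t
  have "(\<integral>\<^sup>+t. H t \<partial>lborel) = (\<Sum>k. \<integral>\<^sup>+t. ennreal (2 ^ k * (cmod (g k t))\<^sup>2) \<partial>lborel)"
    unfolding H_def by (intro nn_integral_suminf) measurable
  also have "\<dots> \<le> (\<Sum>k. ennreal ((1/2) ^ k))"
  proof (intro suminf_le)
    fix k
    have "(\<integral>\<^sup>+t. ennreal (2 ^ k * (cmod (g k t))\<^sup>2) \<partial>lborel)
        = ennreal (2 ^ k) * (\<integral>\<^sup>+t. ennreal ((cmod (g k t))\<^sup>2) \<partial>lborel)"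
      by (simp add: ennreal_mult nn_integral_cmult)
    also have "\<dots> \<le> ennreal (2 ^ k) * ennreal ((1/4) ^ k)"
      unfolding g_def by (intro mult_left_mono dist r) auto
    also have "\<dots> = ennreal ((1/2) ^ k)"
      by (simp flip: ennreal_mult power_mult_distrib)
    finally show "(\<integral>\<^sup>+t. ennreal (2 ^ k * (cmod (g k t))\<^sup>2) \<partial>lborel) \<le> ennreal ((1/2) ^ k)" .
  qed auto
  also have "\<dots> < \<infinity>"
    by (subst suminf_ennreal_eq[OF _ geometric_sums]) auto
  finally have "(\<integral>\<^sup>+t. H t \<partial>lborel) \<noteq> \<infinity>"
    by auto
  then have "AE t in lborel. H t \<noteq> \<infinity>"
    by (intro nn_integral_PInf_AE) (auto simp: H_def)
  then have conv: "AE t in lborel. convergent (\<lambda>k. f (r k) t)"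
  proof eventually_elim
    fix t assume t: "H t \<noteq> \<infinity>"
    define C where "C = enn2real (H t)"
    have HC: "H t = ennreal C" "C \<ge> 0"
      using t by (simp_all add: C_def ennreal_enn2real_if)
    have "cmod (g k t) \<le> sqrt C * sqrt (1/2) ^ k" for k
    proof -
      have "ennreal (2 ^ k * (cmod (g k t))\<^sup>2) \<le> H t"
        unfolding H_def using sum_le_suminf[of _ "{k}", OF summableI] by force
      then have "2 ^ k * (cmod (g k t))\<^sup>2 \<le> C"
        using HC by (simp add: ennreal_le_iff)
      then have "(cmod (g k t))\<^sup>2 \<le> C * (1/2) ^ k"
        by (simp add: field_simps power_divide)
      also have "\<dots> = (sqrt C * sqrt (1/2) ^ k)\<^sup>2"
        using HC by (simp add: power_mult_distrib real_sqrt_power[symmetric] del: real_sqrt_divide)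
      finally show ?thesis
        by (rule power2_le_imp_le) (use HC in auto)
    qed
    moreover have "summable (\<lambda>k. sqrt C * sqrt (1/2) ^ k)"
      by (intro summable_mult summable_geometric) (simp add: real_sqrt_divide)
    ultimately have "summable (\<lambda>k. g k t)"
      by (rule summable_comparison_test'[rotated])
    then have "convergent (\<lambda>k. \<Sum>i<k. g i t)"
      by (simp add: summable_iff_convergent)
    moreover have "(\<Sum>i<k. g i t) = f (r k) t - f (r 0) t" for k
      unfolding g_def by (rule sum_lessThan_telescope)
    ultimately have "convergent (\<lambda>k. f (r k) t - f (r 0) t)"
      by simp
    then have "convergent (\<lambda>k. (f (r k) t - f (r 0) t) + f (r 0) t)"
      by (intro convergent_add convergent_const)
    then show "convergent (\<lambda>k. f (r k) t)"
      by simp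
  qed
  define F where "F t = lim (\<lambda>k. f (r k) t)" for t
  have [measurable]: "F \<in> borel_measurable borel"
    unfolding F_def by measurable
  have Fatou: "(\<integral>\<^sup>+t. ennreal ((cmod (F t - f (r k) t))\<^sup>2) \<partial>lborel) \<le> ennreal ((1/4) ^ k)" for k
  proof -
    have "(\<integral>\<^sup>+t. ennreal ((cmod (F t - f (r k) t))\<^sup>2) \<partial>lborel)
       = (\<integral>\<^sup>+t. liminf (\<lambda>m. ennreal ((cmod (f (r m) t - f (r k) t))\<^sup>2)) \<partial>lborel)"
    proof (intro nn_integral_cong_AE, use conv in eventually_elim)
      fix t assume "convergent (\<lambda>k. f (r k) t)"
      then have "(\<lambda>m. f (r m) t) \<longlonglongrightarrow> F t"
        unfolding F_def by (simp add: convergent_LIMSEQ_iff)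
      then have "(\<lambda>m. ennreal ((cmod (f (r m) t - f (r k) t))\<^sup>2)) \<longlonglongrightarrow>
          ennreal ((cmod (F t - f (r k) t))\<^sup>2)"
        by (intro tendsto_intros)
      then show "ennreal ((cmod (F t - f (r k) t))\<^sup>2)
          = liminf (\<lambda>m. ennreal ((cmod (f (r m) t - f (r k) t))\<^sup>2))"
        by (rule lim_imp_Liminf[OF sequentially_bot, symmetric])
    qed
    also have "\<dots> \<le> liminf (\<lambda>m. \<integral>\<^sup>+t. ennreal ((cmod (f (r m) t - f (r k) t))\<^sup>2) \<partial>lborel)"
      by (intro nn_integral_liminf) measurable
    also have "\<dots> \<le> limsup (\<lambda>m. \<integral>\<^sup>+t. ennreal ((cmod (f (r m) t - f (r k) t))\<^sup>2) \<partial>lborel)"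
      by (rule Liminf_le_Limsup) simp
    also have "\<dots> \<le> ennreal ((1/4) ^ k)"
      by (intro Limsup_bounded eventually_sequentiallyI[of k] dist r) auto
    finally show ?thesis .
  qed
  have sqd: "sq_integrable (\<lambda>t. F t - f (r k) t)" for k
    using Fatou[of k] unfolding sq_integrable_def
    by (auto simp: integrable_iff_bounded top_unique less_top[symmetric])
  from sq_integrable_add[OF sqd f(1), of 0 "r 0"] have sqF: "sq_integrable F"
    by simp
  have near: "norm (abs_l2 F - X (r k)) \<le> (1/2) ^ k" for k
  proof -
    have "ennreal ((norm (abs_l2 F - X (r k)))\<^sup>2) \<le> ennreal ((1/4) ^ k)"
      using Fatou[of k] by (simp add: nn_integral_eq_norm_l2[OF sqd] f abs_l2_diff[OF sqF])
    then have "(norm (abs_l2 F - X (r k)))\<^sup>2 \<le> ((1/2) ^ k)\<^sup>2"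
      by (simp add: ennreal_le_iff power2_eq_square flip: power_mult_distrib)
    then show ?thesis
      by (rule power2_le_imp_le) simp
  qed
  have "X \<longlonglongrightarrow> abs_l2 F"
  proof (rule LIMSEQ_I)
    fix e :: real assume "0 < e"
    then obtain k where k: "(1/2) ^ k < e / 2"
      using real_arch_pow_inv[of "e/2" "1/2"] by auto
    show "\<exists>no. \<forall>n\<ge>no. norm (X n - abs_l2 F) < e"
    proof (intro exI allI impI)
      fix n assume "N k \<le> n"
      have "norm (X n - abs_l2 F) \<le> norm (X n - X (r k)) + norm (abs_l2 F - X (r k))"
        using norm_triangle_ineq4[of "X n - X (r k)" "abs_l2 F - X (r k)"] by simp
      also have "\<dots> < e"
        using N[OF \<open>N k \<le> n\<close> r[OF order_refl]] near[of k] k by linarith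
      finally show "norm (X n - abs_l2 F) < e" .
    qed
  qed
  then show ?thesis
    by (auto simp: convergent_def)
qed

instance l2 :: (euclidean_space) banach
  by standard (rule Cauchy_convergent_l2)

section \<open>Orthonormal systems and bases\<close>

text \<open>
  Indexed families cover both the singular vectors of an operator, indexed by \<open>nat\<close>, and orthonormal
  bases, which are sets indexed by themselves.
\<close>

definition orthonormal_on :: "'i set \<Rightarrow> ('i \<Rightarrow> 'a::euclidean_space l2) \<Rightarrow> bool" where
  "orthonormal_on I e \<longleftrightarrow> (\<forall>i\<in>I. \<forall>j\<in>I. cinner (e i) (e j) = (if i = j then 1 else 0))"

lemma orthonormal_onD:
  "orthonormal_on I e \<Longrightarrow> i \<in> I \<Longrightarrow> j \<in> I \<Longrightarrow> cinner (e i) (e j) = (if i = j then 1 else 0)"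
  by (simp add: orthonormal_on_def)

lemma orthonormal_seq_iff: "orthonormal_seq e \<longleftrightarrow> orthonormal_on UNIV e"
  by (simp add: orthonormal_seq_def orthonormal_on_def)

lemma orthonormal_basis_orthonormal_on: "orthonormal_basis E \<Longrightarrow> orthonormal_on E (\<lambda>x. x)"
  by (simp add: orthonormal_basis_def orthonormal_on_def)

lemma norm_orthonormal:
  assumes "orthonormal_on I e" "i \<in> I"
  shows "norm (e i) = 1"
proof -
  have "complex_of_real ((norm (e i))\<^sup>2) = of_real 1"
    unfolding cinner_eq_norm[symmetric] using orthonormal_onD[OF assms(1,2,2)] by simp
  then have "(norm (e i))\<^sup>2 = 1\<^sup>2"
    unfolding of_real_eq_iff by simp
  then show ?thesis
    by (rule power2_eq_imp_eq) auto
qed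

lemma norm_sum_orthonormal:
  assumes "orthonormal_on I e" "finite F" "F \<subseteq> I"
  shows "(norm (\<Sum>i\<in>F. scaleC (c i) (e i)))\<^sup>2 = (\<Sum>i\<in>F. (cmod (c i))\<^sup>2)"
proof -
  have "cinner (\<Sum>i\<in>F. scaleC (c i) (e i)) (\<Sum>j\<in>F. scaleC (c j) (e j))
      = (\<Sum>i\<in>F. \<Sum>j\<in>F. c i * (cnj (c j) * cinner (e i) (e j)))"
    unfolding cinner_sum_left cinner_sum_right cinner_scaleC_left cinner_scaleC_right sum_distrib_left
    by (subst sum.swap) (simp add: mult_ac)
  also have "\<dots> = (\<Sum>i\<in>F. \<Sum>j\<in>F. if i = j then c i * cnj (c j) else 0)"
    by (intro sum.cong refl) (use assms in \<open>auto simp: orthonormal_onD subset_eq\<close>)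
  also have "\<dots> = (\<Sum>i\<in>F. complex_of_real ((cmod (c i))\<^sup>2))"
    using assms(2) by (simp add: complex_norm_square del: of_real_power)
  also have "\<dots> = of_real (\<Sum>i\<in>F. (cmod (c i))\<^sup>2)"
    by simp
  finally show ?thesis
    unfolding cinner_eq_norm of_real_eq_iff .
qed

text \<open>
  The projection \<open>s\<close> of \<open>x\<close> onto the span satisfies \<open>\<langle>x, s\<rangle> = \<parallel>s\<parallel>\<^sup>2\<close>, so the Cauchy--Schwarz inequality
  already gives \<open>\<parallel>s\<parallel> \<le> \<parallel>x\<parallel>\<close>.
\<close>

lemma Bessel_inequality:
  assumes "orthonormal_on I e" "finite F" "F \<subseteq> I"
  shows "(\<Sum>i\<in>F. (cmod (cinner x (e i)))\<^sup>2) \<le> (norm x)\<^sup>2"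
proof -
  define s where "s = (\<Sum>i\<in>F. scaleC (cinner x (e i)) (e i))"
  have s: "(norm s)\<^sup>2 = (\<Sum>i\<in>F. (cmod (cinner x (e i)))\<^sup>2)"
    unfolding s_def by (rule norm_sum_orthonormal[OF assms])
  have "cinner x s = of_real ((norm s)\<^sup>2)"
    unfolding s by (simp add: s_def cinner_sum_right cinner_scaleC_right mult.commute
        complex_norm_square del: of_real_power)
  then have "(norm s)\<^sup>2 = cmod (cinner x s)"
    by (simp del: of_real_power)
  also have "\<dots> \<le> norm x * norm s"
    by (rule cinner_Cauchy_Schwarz)
  finally have "norm s \<le> norm x"
    by (cases "norm s = 0") (auto simp: power2_eq_square)
  then show ?thesis
    unfolding s[symmetric] by (intro power_mono) auto
qed

lemma sum_cmod_coefficients_le: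
  assumes "orthonormal_on I e" "finite F" "F \<subseteq> I"
  shows "(\<Sum>i\<in>F. cmod (cinner x (e i) * cinner (e i) y)) \<le> norm x * norm y"
proof -
  have L2: "L2_set (\<lambda>i. cmod (cinner z (e i))) F \<le> norm z" for z
    unfolding L2_set_def using Bessel_inequality[OF assms, of z]
    by (metis norm_ge_zero real_sqrt_le_mono real_sqrt_unique)
  have "cmod (cinner (e i) y) = cmod (cinner y (e i))" for i
    by (subst cinner_commute) simp
  then have "(\<Sum>i\<in>F. cmod (cinner x (e i) * cinner (e i) y))
      = (\<Sum>i\<in>F. \<bar>cmod (cinner x (e i))\<bar> * \<bar>cmod (cinner y (e i))\<bar>)"
    by (simp add: norm_mult)
  also have "\<dots> \<le> L2_set (\<lambda>i. cmod (cinner x (e i))) F * L2_set (\<lambda>i. cmod (cinner y (e i))) F"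
    by (rule L2_set_mult_ineq)
  also have "\<dots> \<le> norm x * norm y"
    by (intro mult_mono L2) auto
  finally show ?thesis .
qed

text \<open>
  Such a series need not converge absolutely, so the Cauchy criterion is applied to the net of
  finite partial sums: a difference of two partial sums is controlled by a tail of the series of
  squared coefficients.
\<close>

lemma orthonormal_series_summable:
  fixes e :: "'i \<Rightarrow> 'a::euclidean_space l2"
  assumes e: "orthonormal_on I e" and c: "(\<lambda>i. (cmod (c i))\<^sup>2) summable_on I"
  shows "(\<lambda>i. scaleC (c i) (e i)) summable_on I"
proof -
  let ?f = "\<lambda>i. scaleC (c i) (e i)" and ?q = "\<lambda>i. (cmod (c i))\<^sup>2"
  from c obtain L where L: "(sum ?q \<longlongrightarrow> L) (finite_subsets_at_top I)"
    by (auto simp: summable_on_def has_sum_def)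
  have "\<exists>P. eventually P (finite_subsets_at_top I) \<and>
      (\<forall>F F'. P F \<and> P F' \<longrightarrow> dist (sum ?f F) (sum ?f F') < d)" if "d > 0" for d
  proof -
    have "0 < (d / 2)\<^sup>2 / 2"
      using \<open>d > 0\<close> by simp
    from tendstoD[OF L this] obtain F0 where F0: "finite F0" "F0 \<subseteq> I"
      "\<And>F. finite F \<Longrightarrow> F0 \<subseteq> F \<Longrightarrow> F \<subseteq> I \<Longrightarrow> dist (sum ?q F) L < (d / 2)\<^sup>2 / 2"
      unfolding eventually_finite_subsets_at_top by metis
    define P where "P F \<longleftrightarrow> finite F \<and> F0 \<subseteq> F \<and> F \<subseteq> I" for F
    have near: "dist (sum ?f F) (sum ?f F0) < d / 2" if "P F" for F
    proof -
      have "(norm (sum ?f F - sum ?f F0))\<^sup>2 = (norm (sum ?f (F - F0)))\<^sup>2"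
        using that F0 by (subst sum_diff) (auto simp: P_def)
      also have "\<dots> = sum ?q (F - F0)"
        using that by (intro norm_sum_orthonormal[OF e]) (auto simp: P_def)
      also have "\<dots> = sum ?q F - sum ?q F0"
        using that F0 by (subst sum_diff) (auto simp: P_def)
      also have "\<dots> < (d / 2)\<^sup>2"
      proof -
        have "dist (sum ?q F) L < (d / 2)\<^sup>2 / 2" "dist (sum ?q F0) L < (d / 2)\<^sup>2 / 2"
          using F0 that by (auto simp: P_def)
        then show ?thesis
          unfolding dist_real_def abs_less_iff by linarith
      qed
      finally show ?thesis
        unfolding dist_norm by (rule power2_less_imp_less) (use \<open>d > 0\<close> in simp)
    qed
    have "eventually P (finite_subsets_at_top I)"
      unfolding eventually_finite_subsets_at_top P_def using F0 by blast
    moreover have "dist (sum ?f F) (sum ?f F') < d" if "P F" "P F'" for F F'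
      using near[OF that(1)] near[OF that(2)] by (rule dist_triangle_half_l)
    ultimately show ?thesis
      by blast
  qed
  then have "cauchy_filter (filtermap (sum ?f) (finite_subsets_at_top I))"
    by (simp add: cauchy_filter_metric_filtermap)
  moreover have "complete (UNIV :: 'a l2 set)"
    by (meson Cauchy_convergent UNIV_I complete_def convergent_def)
  ultimately obtain l where "(sum ?f \<longlongrightarrow> l) (finite_subsets_at_top I)"
    using complete_uniform[where S = UNIV] by (force simp add: filterlim_def)
  then show ?thesis
    by (auto simp: summable_on_def has_sum_def)
qed

lemma cinner_has_sum_orthonormal:
  assumes "orthonormal_on I e" "((\<lambda>i. scaleC (c i) (e i)) has_sum x) I" "j \<in> I"
  shows "cinner x (e j) = c j"
proof -
  have "((\<lambda>i. cinner (scaleC (c i) (e i)) (e j)) has_sum cinner x (e j)) I"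
    by (rule has_sum_bounded_linear[OF bounded_linear_cinner_left assms(2)])
  also have "?this \<longleftrightarrow> ((\<lambda>i. cinner (scaleC (c i) (e i)) (e j)) has_sum cinner x (e j)) {j}"
    using assms by (intro has_sum_cong_neutral) (auto simp: cinner_scaleC_left orthonormal_onD)
  finally have "((\<lambda>i. cinner (scaleC (c i) (e i)) (e j)) has_sum cinner x (e j)) {j}" .
  then have "cinner x (e j) = cinner (scaleC (c j) (e j)) (e j)"
    by (simp add: has_sum_finite_iff)
  then show ?thesis
    using assms by (simp add: cinner_scaleC_left orthonormal_onD)
qed

text \<open>
  This is where completeness enters: the series of projections converges to some \<open>y\<close>, and \<open>x - y\<close> is
  orthogonal to the basis, so it vanishes by maximality.
\<close>

lemma orthonormal_basis_expansion:
  assumes "orthonormal_basis E"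
  shows "((\<lambda>e. scaleC (cinner x e) e) has_sum x) E"
proof -
  note E = orthonormal_basis_orthonormal_on[OF assms]
  have "(\<lambda>e. (cmod (cinner x e))\<^sup>2) summable_on E"
    by (rule nonneg_bounded_partial_sums_imp_summable_on[where C = "(norm x)\<^sup>2"])
      (auto intro!: eventually_finite_subsets_at_top_weakI Bessel_inequality[OF E])
  from orthonormal_series_summable[OF E this] obtain y
    where y: "((\<lambda>e. scaleC (cinner x e) e) has_sum y) E"
    by (auto simp: summable_on_def)
  have "cinner (x - y) e = 0" if "e \<in> E" for e
    using cinner_has_sum_orthonormal[OF E y that] by (simp add: cinner_diff_left)
  then have "x - y = 0"
    using assms unfolding orthonormal_basis_def by blast
  with y show ?thesis
    by simp
qed

lemma Parseval_identity:
  assumes "orthonormal_basis E"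
  shows "((\<lambda>e. cinner x e * cinner e y) has_sum cinner x y) E"
  using has_sum_bounded_linear[OF bounded_linear_cinner_left[of y] orthonormal_basis_expansion[OF assms, of x]]
  by (simp add: cinner_scaleC_left)

text \<open>
  A basis is a maximal orthonormal set. At least one is needed for \<open>op_trace\<close> to be determined, since
  it is the number to which the diagonal sums over all bases converge.
\<close>

lemma orthonormal_basis_exists:
  fixes A :: "'a::euclidean_space l2 set"
  assumes "orthonormal_on A (\<lambda>x. x)"
  obtains E where "orthonormal_basis E" "A \<subseteq> E"
proof -
  define \<A> where "\<A> = {E :: 'a l2 set. A \<subseteq> E \<and> orthonormal_on E (\<lambda>x. x)}"
  have "\<exists>M\<in>\<A>. \<forall>X\<in>\<A>. M \<subseteq> X \<longrightarrow> X = M"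
  proof (rule subset_Zorn_nonempty)
    show "\<A> \<noteq> {}"
      using assms by (auto simp: \<A>_def)
    fix \<C> assume C: "\<C> \<noteq> {}" "subset.chain \<A> \<C>"
    have "cinner x y = (if x = y then 1 else 0)" if xy: "x \<in> \<Union>\<C>" "y \<in> \<Union>\<C>" for x y
    proof -
      obtain X Y where "X \<in> \<C>" "x \<in> X" "Y \<in> \<C>" "y \<in> Y"
        using xy by blast
      moreover from this C have "X \<subseteq> Y \<or> Y \<subseteq> X"
        unfolding subset_chain_def by blast
      ultimately obtain Z where "Z \<in> \<C>" "x \<in> Z" "y \<in> Z"
        by blast
      moreover from this C have "Z \<in> \<A>"
        unfolding subset_chain_def by blast
      ultimately show ?thesis
        by (simp add: \<A>_def orthonormal_on_def)
    qed
    moreover have "A \<subseteq> \<Union>\<C>"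
      using C unfolding subset_chain_def \<A>_def by blast
    ultimately show "\<Union>\<C> \<in> \<A>"
      by (simp add: \<A>_def orthonormal_on_def)
  qed
  then obtain E where "E \<in> \<A>" and max_\<A>: "\<forall>X\<in>\<A>. E \<subseteq> X \<longrightarrow> X = E"
    by (elim bexE)
  then have E: "A \<subseteq> E" "orthonormal_on E (\<lambda>x. x)"
    by (simp_all add: \<A>_def)
  have max: "X = E" if "A \<subseteq> X" "orthonormal_on X (\<lambda>x. x)" "E \<subseteq> X" for X
    using max_\<A> that unfolding \<A>_def by (metis mem_Collect_eq)
  have "x = 0" if x: "\<forall>e\<in>E. cinner x e = 0" for x
  proof (rule ccontr)
    assume "x \<noteq> 0"
    define u where "u = x /\<^sub>R norm x"
    have "cinner u u = 1"
      using \<open>x \<noteq> 0\<close> by (simp add: u_def cinner_scaleR_left cinner_scaleR_right cinner_eq_norm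
          scaleR_conv_of_real power2_eq_square)
    moreover have ue: "cinner u e = 0" "cinner e u = 0" if "e \<in> E" for e
    proof -
      show "cinner u e = 0"
        using x that by (simp add: u_def cinner_scaleR_left)
      then show "cinner e u = 0"
        by (subst cinner_commute) simp
    qed
    ultimately have "orthonormal_on (insert u E) (\<lambda>x. x)"
      using E(2) unfolding orthonormal_on_def by auto
    then have "u \<in> E"
      using max[of "insert u E"] E(1) by blast
    with ue \<open>cinner u u = 1\<close> show False
      by simp
  qed
  then have "orthonormal_basis E"
    using E(2) by (simp add: orthonormal_basis_def orthonormal_on_def)
  with E(1) show ?thesis
    using that by blast
qed

text \<open>
  If \<open>E\<close> were finite, then \<open>1 = \<parallel>g n\<parallel>\<^sup>2\<close> would be a finite sum of terms \<open>\<bar>\<langle>g n, e\<rangle>\<bar>\<^sup>2\<close>, each of which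
  tends to \<open>0\<close> with \<open>n\<close> by Bessel's inequality for \<open>g\<close>.
\<close>

lemma infinite_orthonormal_basis:
  fixes g :: "nat \<Rightarrow> 'a::euclidean_space l2"
  assumes g: "orthonormal_seq g" and E: "orthonormal_basis (E :: 'a l2 set)"
  shows "infinite E"
proof
  assume "finite E"
  have g': "orthonormal_on UNIV g"
    using g by (simp add: orthonormal_seq_iff)
  have lim: "(\<lambda>n. cinner (g n) x * cinner x (g n)) \<longlonglongrightarrow> 0" for x :: "'a l2"
  proof -
    have "summable (\<lambda>n. (cmod (cinner x (g n)))\<^sup>2)"
      by (rule bounded_imp_summable[where B = "(norm x)\<^sup>2"])
        (auto intro!: Bessel_inequality[OF g'])
    then have "(\<lambda>n. (cmod (cinner x (g n)))\<^sup>2) \<longlonglongrightarrow> 0"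
      by (rule summable_LIMSEQ_zero)
    moreover have "cmod (cinner (g n) x * cinner x (g n)) = (cmod (cinner x (g n)))\<^sup>2" for n
      by (subst (1) cinner_commute) (simp add: norm_mult power2_eq_square)
    ultimately show ?thesis
      by (subst tendsto_norm_zero_iff[symmetric]) simp
  qed
  have "(\<Sum>x\<in>E. cinner (g n) x * cinner x (g n)) = 1" for n
    using Parseval_identity[OF E, of "g n" "g n"] g \<open>finite E\<close>
    by (simp add: has_sum_finite_iff orthonormal_seq_def)
  moreover have "(\<lambda>n. \<Sum>x\<in>E. cinner (g n) x * cinner x (g n)) \<longlonglongrightarrow> (\<Sum>x\<in>E. 0)"
    by (intro tendsto_sum lim)
  ultimately have "(\<lambda>n::nat. 1::complex) \<longlonglongrightarrow> 0"
    by simp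
  then show False
    by (simp add: LIMSEQ_const_iff)
qed

text \<open>
  A singular value decomposition consists of infinite orthonormal sequences even for an operator of
  rank one, so its two vectors have to be continued to such sequences. The terms come from a basis
  through the given vector.
\<close>

lemma orthonormal_seq_extending:
  fixes a :: "'a::euclidean_space l2"
  assumes g: "orthonormal_seq (g :: nat \<Rightarrow> 'a l2)" and a: "norm a = 1"
  obtains e where "orthonormal_seq e" "e 0 = a"
proof -
  have "orthonormal_on {a} (\<lambda>x. x)"
    using a by (simp add: orthonormal_on_def cinner_eq_norm)
  then obtain E where E: "orthonormal_basis E" "a \<in> E"
    using orthonormal_basis_exists[of "{a}"] by auto
  then have "infinite (E - {a})"
    using infinite_orthonormal_basis[OF g] by simp
  then obtain f :: "nat \<Rightarrow> 'a l2" where f: "inj f" "range f \<subseteq> E - {a}"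
    using infinite_countable_subset by blast
  define e where "e = case_nat a f"
  have "e n \<in> E" for n
    using f E by (auto simp: e_def split: nat.split)
  moreover have "e m = e n \<longleftrightarrow> m = n" for m n
    using f by (auto simp: e_def inj_eq split: nat.split)
  ultimately have "orthonormal_seq e"
    using E(1) by (simp add: orthonormal_seq_def orthonormal_basis_def)
  then show ?thesis
    using that[of e] by (simp add: e_def)
qed

section \<open>Riesz representation and adjoints\<close>

text \<open>
  The representing vector has the coefficients \<open>L e\<close> with respect to an orthonormal basis; they are
  square summable because testing \<open>L\<close> against \<open>v = \<Sum>e\<in>F. L e * e\<close> gives \<open>L v = \<parallel>v\<parallel>\<^sup>2\<close>.
\<close>

lemma Riesz_representation:
  fixes L :: "'a::euclidean_space l2 \<Rightarrow> complex"
  assumes L: "bounded_linear L" and antilinear: "\<And>c x. L (scaleC c x) = cnj c * L x"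
  obtains w where "\<And>x. L x = cinner w x"
proof -
  interpret L: bounded_linear L by fact
  obtain E :: "'a l2 set" where E: "orthonormal_basis E"
    using orthonormal_basis_exists[of "{}"] by (auto simp: orthonormal_on_def)
  note E' = orthonormal_basis_orthonormal_on[OF E]
  obtain K where K: "\<And>x. cmod (L x) \<le> norm x * K" "K \<ge> 0"
    using L.nonneg_bounded by blast
  have "(\<Sum>e\<in>F. (cmod (L e))\<^sup>2) \<le> K\<^sup>2" if F: "finite F" "F \<subseteq> E" for F
  proof -
    define v where "v = (\<Sum>e\<in>F. scaleC (L e) e)"
    have v: "(norm v)\<^sup>2 = (\<Sum>e\<in>F. (cmod (L e))\<^sup>2)"
      unfolding v_def by (rule norm_sum_orthonormal[OF E' F])
    have "L v = of_real ((norm v)\<^sup>2)"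
      unfolding v by (simp add: v_def L.sum antilinear mult.commute complex_norm_square
          del: of_real_power)
    then have "(norm v)\<^sup>2 = cmod (L v)"
      by (simp del: of_real_power)
    also have "\<dots> \<le> norm v * K"
      by (rule K)
    finally have "norm v \<le> K"
      using K(2) by (cases "norm v = 0") (auto simp: power2_eq_square)
    then show ?thesis
      unfolding v[symmetric] by (intro power_mono) auto
  qed
  then have "(\<lambda>e. (cmod (L e))\<^sup>2) summable_on E"
    by (intro nonneg_bounded_partial_sums_imp_summable_on[where C = "K\<^sup>2"])
      (auto intro!: eventually_finite_subsets_at_top_weakI)
  from orthonormal_series_summable[OF E' this] obtain w
    where w: "((\<lambda>e. scaleC (L e) e) has_sum w) E"
    by (auto simp: summable_on_def)
  have "L x = cinner w x" for x
  proof -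
    have "((\<lambda>e. cnj (cinner x e) * L e) has_sum L x) E"
      using has_sum_bounded_linear[OF L orthonormal_basis_expansion[OF E, of x]]
      by (simp add: antilinear)
    moreover have "((\<lambda>e. L e * cinner e x) has_sum cinner w x) E"
      using has_sum_bounded_linear[OF bounded_linear_cinner_left w]
      by (simp add: cinner_scaleC_left)
    moreover have "cnj (cinner x e) * L e = L e * cinner e x" for e
      by (subst (2) cinner_commute) simp
    ultimately show ?thesis
      by (metis (no_types, lifting) has_sum_cong has_sum_unique)
  qed
  then show ?thesis
    using that by blast
qed

lemma adj_eqI:
  assumes "\<And>x y. cinner (T x) y = cinner x (A y)"
  shows "adj T = A"
  unfolding adj_def
proof (rule the_equality)
  fix A' assume A': "\<forall>x y. cinner (T x) y = cinner x (A' y)"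
  show "A' = A"
  proof (rule ext, rule cinner_eqI)
    fix x y
    have "cinner y (A' x) = cinner y (A x)"
      using A' assms by metis
    then show "cinner (A' x) y = cinner (A x) y"
      by (metis cinner_commute)
  qed
qed (use assms in blast)

text \<open>
  For fixed \<open>y\<close>, the adjoint at \<open>y\<close> is the vector representing the antilinear functional \<open>x \<mapsto> \<langle>y, T x\<rangle>\<close>.
\<close>

lemma cinner_adj:
  assumes "bounded_op T"
  shows "cinner (T x) y = cinner x (adj T y)"
proof -
  have T: "bounded_linear T" "\<And>c x. T (scaleC c x) = scaleC c (T x)"
    using assms by (auto simp: bounded_op_def)
  have "\<exists>w. \<forall>x. cinner y (T x) = cinner w x" for y
  proof -
    have "bounded_linear (\<lambda>x. cinner y (T x))"
      by (rule bounded_linear_compose[OF bounded_linear_cinner_right T(1)])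
    then show ?thesis
      by (rule Riesz_representation) (auto simp: T cinner_scaleC_right)
  qed
  then obtain A where A: "\<And>x y. cinner y (T x) = cinner (A y) x"
    by metis
  have *: "cinner (T x) y = cinner x (A y)" for x y
    by (subst (1 2) cinner_commute) (simp add: A)
  with adj_eqI[of T A, OF *] show ?thesis
    by simp
qed

section \<open>Bounded operators, time-frequency shifts and parity\<close>

lemma bounded_op_norm_bound:
  assumes "bounded_op T"
  obtains K where "K \<ge> 0" "\<And>x. norm (T x) \<le> K * norm x"
  using assms bounded_linear.nonneg_bounded[of T] by (auto simp: bounded_op_def mult.commute)

lemma cinner_adj_left:
  assumes "bounded_op T"
  shows "cinner (adj T x) y = cinner x (T y)"
  by (subst (1 2) cinner_commute) (simp add: cinner_adj[OF assms])

lemma integral_affine_unit: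
  fixes f :: "'a::euclidean_space \<Rightarrow> complex"
  assumes "\<bar>c\<bar> = 1" and [measurable]: "f \<in> borel_measurable borel"
  shows "(\<integral>t. f (x + c *\<^sub>R t) \<partial>lborel) = (\<integral>t. f t \<partial>lborel)"
  by (subst (2) lborel_distr_affine_unit[OF assms(1), of x, symmetric], subst integral_distr) auto

lemma tf_shift_cinner: "cinner (tf_shift z \<psi>) (tf_shift z \<phi>) = cinner \<psi> \<phi>"
  for \<psi> \<phi> :: "'a::euclidean_space l2"
proof transfer
  fix z :: "'a \<times> 'a" and f g :: "'a \<Rightarrow> complex"
  assume "l2_rel f f" "l2_rel g g"
  then have [measurable]: "f \<in> borel_measurable borel" "g \<in> borel_measurable borel"
    by (auto simp: l2_rel_def sq_integrable_def)
  obtain x \<omega> where z: "z = (x, \<omega>)"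
    by fastforce
  let ?e = "\<lambda>t. exp (2 * of_real pi * \<i> * of_real (\<omega> \<bullet> t)) :: complex"
  have "?e t * cnj (?e t) = of_real ((cmod (?e t))\<^sup>2)" for t
    by (rule complex_norm_square[symmetric])
  then have e: "?e t * cnj (?e t) = 1" for t
    by simp
  have "(?e t * f (t - x)) * cnj (?e t * g (t - x)) = (?e t * cnj (?e t)) * (f (t - x) * cnj (g (t - x)))"
    for t by (simp only: complex_cnj_mult mult_ac)
  then have "(\<integral>t. (?e t * f (t - x)) * cnj (?e t * g (t - x)) \<partial>lborel)
      = (\<integral>t. f (t - x) * cnj (g (t - x)) \<partial>lborel)"
    by (simp only: e mult_1_left)
  also have "\<dots> = (\<integral>t. f t * cnj (g t) \<partial>lborel)"
    using integral_affine_unit[of 1 "\<lambda>t. f t * cnj (g t)" "- x"] by simp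
  finally show "(\<integral>t. (case z of (x, \<omega>) \<Rightarrow> \<lambda>\<psi> t. exp (2 * of_real pi * \<i> * of_real (\<omega> \<bullet> t)) * \<psi> (t - x)) f t *
      cnj ((case z of (x, \<omega>) \<Rightarrow> \<lambda>\<psi> t. exp (2 * of_real pi * \<i> * of_real (\<omega> \<bullet> t)) * \<psi> (t - x)) g t) \<partial>lborel)
     = (\<integral>t. f t * cnj (g t) \<partial>lborel)"
    by (simp add: z)
qed

lemma norm_eq_if_cinner_eq: "cinner x x = cinner y y \<Longrightarrow> norm x = norm y"
  for x y :: "'a::euclidean_space l2"
  by (simp add: norm_eq_sqrt_inner inner_l2_def)

lemma norm_tf_shift: "norm (tf_shift z \<psi>) = norm \<psi>" for \<psi> :: "'a::euclidean_space l2"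
  by (rule norm_eq_if_cinner_eq) (rule tf_shift_cinner)

lemma bounded_opI:
  fixes T :: "'a::euclidean_space op"
  assumes "\<And>x y. T (x + y) = T x + T y" "\<And>c x. T (scaleC c x) = scaleC c (T x)"
    "\<And>x. norm (T x) \<le> K * norm x"
  shows "bounded_op T"
  unfolding bounded_op_def using assms
  by (auto intro!: bounded_linear_intro[of T K] simp: scaleR_l2_def mult.commute)

text \<open>
  Linearity follows from preservation of inner products alone: the square of the norm of the defect
  expands to \<open>0\<close>. This avoids computing with representatives.
\<close>

lemma tf_shift_add: "tf_shift z (x + y) = tf_shift z x + tf_shift z y"
  for x y :: "'a::euclidean_space l2"
proof -
  have "(tf_shift z (x + y) - tf_shift z x) - tf_shift z y = 0"
    by (rule cinner_self_eq_0[THEN iffD1])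
      (simp add: cinner_diff_left cinner_diff_right tf_shift_cinner cinner_add_left cinner_add_right)
  then show ?thesis
    by (simp add: algebra_simps)
qed

lemma tf_shift_scaleC: "tf_shift z (scaleC c x) = scaleC c (tf_shift z x)"
  for x :: "'a::euclidean_space l2"
proof -
  have "tf_shift z (scaleC c x) - scaleC c (tf_shift z x) = 0"
    by (rule cinner_self_eq_0[THEN iffD1])
      (simp add: cinner_diff_left cinner_diff_right tf_shift_cinner cinner_scaleC_left
        cinner_scaleC_right)
  then show ?thesis
    by simp
qed

lemma bounded_op_tf_shift: "bounded_op (tf_shift z :: 'a::euclidean_space op)"
  by (rule bounded_opI[of _ 1]) (simp_all add: tf_shift_add tf_shift_scaleC norm_tf_shift)

lemma norm_adj_tf_shift_le: "norm (adj (tf_shift z) \<psi>) \<le> norm \<psi>" for \<psi> :: "'a::euclidean_space l2"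
proof -
  let ?a = "adj (tf_shift z) \<psi>"
  have "complex_of_real ((norm ?a)\<^sup>2) = cinner (tf_shift z ?a) \<psi>"
    by (simp add: cinner_adj[OF bounded_op_tf_shift] cinner_eq_norm[symmetric] del: of_real_power)
  then have "(norm ?a)\<^sup>2 = cmod (cinner (tf_shift z ?a) \<psi>)"
    by (metis abs_of_nonneg norm_of_real zero_le_power2)
  also have "\<dots> \<le> norm ?a * norm \<psi>"
    using cinner_Cauchy_Schwarz[of "tf_shift z ?a" \<psi>] by (simp add: norm_tf_shift)
  finally show ?thesis
    by (cases "norm ?a = 0") (auto simp: power2_eq_square)
qed

lemma parity_parity: "parity (parity \<psi>) = \<psi>" for \<psi> :: "'a::euclidean_space l2"
  by transfer (auto simp: l2_rel_def)

lemma cinner_parity: "cinner (parity \<psi>) \<phi> = cinner \<psi> (parity \<phi>)" for \<psi> \<phi> :: "'a::euclidean_space l2"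
proof transfer
  fix f g :: "'a \<Rightarrow> complex"
  assume "l2_rel f f" "l2_rel g g"
  then have [measurable]: "f \<in> borel_measurable borel" "g \<in> borel_measurable borel"
    by (auto simp: l2_rel_def sq_integrable_def)
  show "(\<integral>t. f (- t) * cnj (g t) \<partial>lborel) = (\<integral>t. f t * cnj (g (- t)) \<partial>lborel)"
    using integral_affine_unit[of "- 1" "\<lambda>t. f t * cnj (g (- t))" 0] by simp
qed

text \<open>
  The parity operator is a selfadjoint involution, so conjugation with it commutes with taking
  adjoints and squares to the identity.
\<close>

lemma check_adj_check:
  assumes "bounded_op (T :: 'a::euclidean_space op)"
  shows "check (adj (check T)) = adj T"
proof -
  have "adj (check T) = parity \<circ> adj T \<circ> parity"
    by (rule adj_eqI) (simp add: check_def cinner_parity cinner_adj[OF assms])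
  then show ?thesis
    by (simp add: check_def fun_eq_iff parity_parity)
qed

section \<open>Singular value decompositions and traces\<close>

text \<open>
  With \<open>C\<close> a bound for the singular values, orthonormality of \<open>f\<close> and Bessel's inequality for \<open>e\<close> bound
  every partial sum at \<open>x\<close> by \<open>C * \<parallel>x\<parallel>\<close>.
\<close>

lemma singular_value_decomp_bounded_op:
  fixes T :: "'a::euclidean_space op"
  assumes "singular_value_decomp T s e f"
  shows "bounded_op T"
proof -
  have s: "\<And>n. 0 \<le> s n" "s \<longlonglongrightarrow> 0" and e: "orthonormal_on UNIV e" and f: "orthonormal_on UNIV f"
    and T: "\<And>\<psi>. (\<lambda>n. scaleC (of_real (s n) * cinner \<psi> (e n)) (f n)) sums T \<psi>"
    using assms by (auto simp: singular_value_decomp_def orthonormal_seq_iff)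
  from s(2) obtain C where C: "C > 0" "\<And>n. \<bar>s n\<bar> \<le> C"
    by (metis BseqE convergentI convergent_imp_Bseq real_norm_def)
  show ?thesis
  proof (rule bounded_opI)
    fix x y :: "'a l2" and c :: complex
    show "T (x + y) = T x + T y"
      by (rule sums_unique2[OF T]) (use sums_add[OF T[of x] T[of y]] in
          \<open>simp add: cinner_add_left distrib_left scaleC_simps\<close>)
    show "T (scaleC c x) = scaleC c (T x)"
      by (rule sums_unique2[OF T])
        (use bounded_linear.sums[OF bounded_linear_scaleC T[of x], of c] in
          \<open>simp add: cinner_scaleC_left scaleC_simps mult_ac\<close>)
    have "norm (\<Sum>n<N. scaleC (of_real (s n) * cinner x (e n)) (f n)) \<le> C * norm x" for N
    proof (rule power2_le_imp_le)
      have "(norm (\<Sum>n<N. scaleC (of_real (s n) * cinner x (e n)) (f n)))\<^sup>2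
          = (\<Sum>n<N. (s n)\<^sup>2 * (cmod (cinner x (e n)))\<^sup>2)"
        by (subst norm_sum_orthonormal[OF f]) (auto simp: norm_mult power_mult_distrib)
      also have "\<dots> \<le> (\<Sum>n<N. C\<^sup>2 * (cmod (cinner x (e n)))\<^sup>2)"
        using C by (intro sum_mono mult_right_mono) (auto simp: abs_le_square_iff[symmetric])
      also have "\<dots> \<le> C\<^sup>2 * (norm x)\<^sup>2"
        unfolding sum_distrib_left[symmetric]
        by (intro mult_left_mono Bessel_inequality[OF e]) auto
      finally show "(norm (\<Sum>n<N. scaleC (of_real (s n) * cinner x (e n)) (f n)))\<^sup>2
          \<le> (C * norm x)\<^sup>2"
        by (simp add: power_mult_distrib)
    qed (use C in simp)
    then show "norm (T x) \<le> C * norm x"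
      using T[of x] unfolding sums_def
      by (intro tendsto_upperbound[OF tendsto_norm]) auto
  qed
qed

lemma singular_value_decomp_cinner_sums:
  assumes "singular_value_decomp T s e f"
  shows "(\<lambda>n. of_real (s n) * cinner x (e n) * cinner (f n) y) sums cinner (T x) y"
proof -
  have "(\<lambda>n. scaleC (of_real (s n) * cinner x (e n)) (f n)) sums T x"
    using assms by (simp add: singular_value_decomp_def)
  from bounded_linear.sums[OF bounded_linear_cinner_left this, of y] show ?thesis
    by (simp add: cinner_scaleC_left)
qed

text \<open>
  The trace of a nuclear operator. The series in \<open>n\<close> is only required to represent \<open>T\<close> weakly,
  since the trace only sees the numbers \<open>\<langle>T e, e\<rangle>\<close>. Summing the double series
  \<open>\<langle>e, b n\<rangle> \<langle>c n, e\<rangle>\<close> over the basis first gives \<open>\<langle>c n, b n\<rangle>\<close> by Parseval, and its absolute values add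
  up to at most \<open>\<parallel>b n\<parallel> * \<parallel>c n\<parallel>\<close>, so the order of summation may be exchanged.
\<close>

lemma op_trace_nuclear:
  fixes T :: "'a::euclidean_space op"
  assumes T: "\<And>x y. (\<lambda>n. cinner x (b n) * cinner (c n) y) sums cinner (T x) y"
    and summable: "summable (\<lambda>n. norm (b n) * norm (c n))"
  shows "(\<lambda>n. cinner (c n) (b n)) sums op_trace T"
proof -
  define S where "S = (\<Sum>n. cinner (c n) (b n))"
  have abs_summable: "summable (\<lambda>n. norm (cinner (c n) (b n)))"
  proof (rule summable_comparison_test'[OF summable])
    show "norm (norm (cinner (c n) (b n))) \<le> norm (b n) * norm (c n)" for n
      using cinner_Cauchy_Schwarz[of "c n" "b n"] by (simp add: mult.commute)
  qed
  then have S: "(\<lambda>n. cinner (c n) (b n)) sums S"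
    unfolding S_def by (rule summable_sums[OF summable_norm_cancel])
  have trace: "((\<lambda>e. cinner (T e) e) has_sum S) E" if E: "orthonormal_basis E" for E
  proof -
    define f where "f = (\<lambda>(n, e). cinner (c n) e * cinner e (b n))"
    have bound: "(\<Sum>e\<in>F. norm (f (n, e))) \<le> norm (b n) * norm (c n)" if "finite F" "F \<subseteq> E" for n F
      using sum_cmod_coefficients_le[OF orthonormal_basis_orthonormal_on[OF E] that, of "c n" "b n"]
      by (simp add: f_def mult.commute)
    have inner: "(\<lambda>e. norm (f (n, e))) summable_on E" for n
      by (rule nonneg_bounded_partial_sums_imp_summable_on[where C = "norm (b n) * norm (c n)"])
        (auto intro!: eventually_finite_subsets_at_top_weakI bound)
    have "(\<lambda>n. norm (b n) * norm (c n)) summable_on UNIV"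
      using summable by (subst summable_on_UNIV_nonneg_real_iff) auto
    then have "(\<lambda>n. \<Sum>\<^sub>\<infinity>e\<in>E. norm (f (n, e))) summable_on UNIV"
      by (rule summable_on_comparison_test)
        (auto intro!: infsum_le_finite_sums inner bound infsum_nonneg)
    then have "(\<lambda>p. norm (f p)) summable_on UNIV \<times> E"
      by (intro summable_on_SigmaI) (use inner in auto)
    then have f: "f summable_on UNIV \<times> E"
      by (rule abs_summable_summable)
    have "((\<lambda>n. cinner (c n) (b n)) has_sum S) UNIV"
      by (rule norm_summable_imp_has_sum[OF abs_summable S])
    then have "(f has_sum S) (UNIV \<times> E)"
      by (intro has_sum_SigmaI[OF _ _ f]) (auto simp: f_def Parseval_identity[OF E])
    then have swapped: "((\<lambda>(e, n). f (n, e)) has_sum S) (E \<times> UNIV)"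
      by (subst (asm) has_sum_swap)
    show ?thesis
    proof (rule has_sum_SigmaD[OF swapped])
      fix e assume "e \<in> E"
      have "(\<lambda>n. f (n, e)) summable_on UNIV"
        by (rule summable_on_SigmaD1[where f = "\<lambda>e n. f (n, e)", OF _ \<open>e \<in> E\<close>])
          (use swapped in \<open>auto simp: summable_on_def\<close>)
      then obtain t where t: "((\<lambda>n. f (n, e)) has_sum t) UNIV"
        by (auto simp: summable_on_def)
      then have "(\<lambda>n. f (n, e)) sums t"
        by (rule has_sum_imp_sums)
      then have "t = cinner (T e) e"
        using T[of e e] by (simp add: f_def mult.commute sums_unique2)
      with t show "((\<lambda>n. case (e, n) of (e, n) \<Rightarrow> f (n, e)) has_sum cinner (T e) e) UNIV"
        by simp
    qed
  qed
  obtain E :: "'a l2 set" where E: "orthonormal_basis E"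
    using orthonormal_basis_exists[of "{}"] by (auto simp: orthonormal_on_def)
  have "op_trace T = S"
    unfolding op_trace_def
  proof (rule the_equality)
    fix t assume "\<forall>E. orthonormal_basis E \<longrightarrow> ((\<lambda>e. cinner (T e) e) has_sum t) E"
    then show "t = S"
      using trace[OF E] E has_sum_unique by blast
  qed (use trace in blast)
  with S show ?thesis
    by simp
qed

text \<open>
  Writing \<open>\<langle>B R\<^sup>* x, y\<rangle>\<close> as the conjugate of \<open>\<langle>R B\<^sup>* y, x\<rangle>\<close> turns the decomposition of \<open>R\<close> into a weak nuclear
  representation of \<open>B R\<^sup>*\<close>, without a decomposition of \<open>R\<^sup>*\<close>.
\<close>

lemma op_trace_comp_adj:
  fixes B R :: "'a::euclidean_space op"
  assumes B: "bounded_op B" and R: "singular_value_decomp R r a b" and r: "summable r"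
  shows "(\<lambda>n. of_real (r n) * cinner (B (a n)) (b n)) sums op_trace (B \<circ> adj R)"
proof -
  have R': "bounded_op R" and r0: "\<And>n. r n \<ge> 0"
    and a: "orthonormal_on UNIV a" and b: "orthonormal_on UNIV b"
    using R singular_value_decomp_bounded_op[OF R]
    by (auto simp: singular_value_decomp_def orthonormal_seq_iff)
  obtain K where K: "K \<ge> 0" "\<And>x. norm (B x) \<le> K * norm x"
    using bounded_op_norm_bound[OF B] by metis
  have "(\<lambda>n. cinner (scaleC (of_real (r n)) (B (a n))) (b n)) sums op_trace (B \<circ> adj R)"
  proof (rule op_trace_nuclear)
    fix x y :: "'a l2"
    have "cinner ((B \<circ> adj R) x) y = cnj (cinner (R (adj B y)) x)"
      by (simp add: cinner_adj[OF B] cinner_adj_left[OF R'] cinner_commute[of x])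
    moreover have "(\<lambda>n. cnj (of_real (r n) * cinner (adj B y) (a n) * cinner (b n) x))
        sums cnj (cinner (R (adj B y)) x)"
      unfolding sums_cnj by (rule singular_value_decomp_cinner_sums[OF R])
    moreover have "cnj (of_real (r n) * cinner (adj B y) (a n) * cinner (b n) x)
        = cinner x (b n) * cinner (scaleC (of_real (r n)) (B (a n))) y" for n
      by (simp add: cinner_adj_left[OF B] cinner_scaleC_left cinner_commute[of x]
          cinner_commute[of "B (a n)"])
    ultimately show "(\<lambda>n. cinner x (b n) * cinner (scaleC (of_real (r n)) (B (a n))) y)
        sums cinner ((B \<circ> adj R) x) y"
      by simp
  next
    have "norm (B (a n)) \<le> K" for n
      using K(2)[of "a n"] norm_orthonormal[OF a] by simp
    then show "summable (\<lambda>n. norm (b n) * norm (scaleC (of_real (r n)) (B (a n))))"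
      using r0 by (intro summable_comparison_test'[OF summable_mult2[OF r, of K]])
        (auto simp: norm_orthonormal[OF b] norm_scaleC intro!: mult_left_mono)
  qed
  then show ?thesis
    by (simp add: cinner_scaleC_left)
qed

abbreviation shift_op :: "'a::euclidean_space \<times> 'a \<Rightarrow> 'a op \<Rightarrow> 'a op" where
  "shift_op z S \<equiv> tf_shift z \<circ> S \<circ> adj (tf_shift z)"

lemma norm_shift_op_le:
  assumes "K \<ge> 0" "\<And>x. norm (S x) \<le> K * norm x"
  shows "norm (shift_op z S x) \<le> K * norm x"
  using assms(2)[of "adj (tf_shift z) x"] mult_left_mono[OF norm_adj_tf_shift_le[of z x] assms(1)]
  by (simp add: norm_tf_shift)

text \<open>
  In \<open>op_conv R (adj (check S))\<close> the two checks cancel, leaving \<open>tr (R \<pi>(z) S\<^sup>* \<pi>(z)\<^sup>*)\<close>; the factor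
  \<open>\<pi>(z) S\<^sup>* \<pi>(z)\<^sup>*\<close> is then moved onto the right singular vectors of \<open>R\<close>.
\<close>

lemma op_conv_adj_check:
  fixes R S :: "'a::euclidean_space op"
  assumes S: "bounded_op S" and R: "singular_value_decomp R r a b" and r: "summable r"
  shows "(\<lambda>n. of_real (r n) * cinner (shift_op z S (a n)) (b n))
    sums cnj (op_conv R (adj (check S)) z)"
proof -
  have r0: "\<And>n. r n \<ge> 0" and a: "orthonormal_on UNIV a" and b: "orthonormal_on UNIV b"
    using R by (auto simp: singular_value_decomp_def orthonormal_seq_iff)
  obtain K where K: "K \<ge> 0" "\<And>x. norm (S x) \<le> K * norm x"
    using bounded_op_norm_bound[OF S] by metis
  let ?T = "R \<circ> tf_shift z \<circ> adj S \<circ> adj (tf_shift z)"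
  have "op_conv R (adj (check S)) z = op_trace ?T"
    by (simp add: op_conv_def check_adj_check[OF S])
  moreover have "(\<lambda>n. cinner (scaleC (of_real (r n)) (b n)) (shift_op z S (a n))) sums op_trace ?T"
  proof (rule op_trace_nuclear)
    fix x y :: "'a l2"
    let ?x = "tf_shift z (adj S (adj (tf_shift z) x))"
    have "cinner ?x v = cinner x (shift_op z S v)" for v
      by (simp add: cinner_adj[OF bounded_op_tf_shift] cinner_adj_left[OF bounded_op_tf_shift]
          cinner_adj_left[OF S])
    then show "(\<lambda>n. cinner x (shift_op z S (a n)) * cinner (scaleC (of_real (r n)) (b n)) y)
        sums cinner (?T x) y"
      using singular_value_decomp_cinner_sums[OF R, of ?x y]
      by (simp add: cinner_scaleC_left mult_ac)
  next
    have "norm (shift_op z S (a n)) \<le> K" for n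
      using norm_shift_op_le[OF K, of z "a n"] norm_orthonormal[OF a] by simp
    then show "summable (\<lambda>n. norm (shift_op z S (a n)) * norm (scaleC (of_real (r n)) (b n)))"
      using r0 by (intro summable_comparison_test'[OF summable_mult[OF r, of K]])
        (auto simp: norm_orthonormal[OF b] norm_scaleC intro!: mult_right_mono)
  qed
  ultimately have "(\<lambda>n. cnj (cinner (scaleC (of_real (r n)) (b n)) (shift_op z S (a n))))
      sums cnj (op_conv R (adj (check S)) z)"
    by (simp only: sums_cnj)
  moreover have "cnj (cinner (scaleC (of_real (r n)) (b n)) (shift_op z S (a n)))
      = of_real (r n) * cinner (shift_op z S (a n)) (b n)" for n
    by (simp add: cinner_scaleC_left cinner_commute[symmetric])
  ultimately show ?thesis
    by simp
qed

lemma scaleC_zero_left: "scaleC 0 x = 0" for x :: "'a::euclidean_space l2"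
  by (simp flip: norm_eq_zero add: norm_scaleC)

lemma rank_one_singular_value_decomp:
  fixes x y :: "'a::euclidean_space l2"
  assumes g: "orthonormal_seq (g :: nat \<Rightarrow> 'a l2)" and "norm x = 1" "norm y = 1"
  obtains a b where "a 0 = x" "b 0 = y"
    "singular_value_decomp (\<lambda>v. scaleC (cinner v x) y) (\<lambda>n. if n = 0 then 1 else 0) a b"
proof -
  obtain a where a: "orthonormal_seq a" "a 0 = x"
    using orthonormal_seq_extending[OF g assms(2)] .
  obtain b where b: "orthonormal_seq b" "b 0 = y"
    using orthonormal_seq_extending[OF g assms(3)] .
  have "(\<lambda>n. scaleC (of_real (if n = 0 then 1 else 0) * cinner v (a n)) (b n))
      sums scaleC (cinner v x) y" for v
  proof -
    have "(\<lambda>n. scaleC (of_real (if n = 0 then 1 else 0) * cinner v (a n)) (b n))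
      sums (\<Sum>n\<in>{0}. scaleC (of_real (if n = 0 then 1 else 0) * cinner v (a n)) (b n))"
      by (rule sums_finite) (auto simp: scaleC_zero_left)
    then show ?thesis
      by (simp add: a b)
  qed
  moreover have "(\<lambda>n::nat. if n = 0 then 1 else 0 :: real) \<longlonglongrightarrow> 0"
    by (rule tendsto_eventually) (auto intro: eventually_sequentiallyI[of 1])
  ultimately have "singular_value_decomp (\<lambda>v. scaleC (cinner v x) y) (\<lambda>n. if n = 0 then 1 else 0) a b"
    using a b by (simp add: singular_value_decomp_def)
  with a b show ?thesis
    using that by blast
qed

section \<open>Polar decomposition of complex measures\<close>

text \<open>
  Only the values on \<open>sets M\<close> are meaningful. Countable additivity with real values already forces
  these values to be bounded.
\<close>

locale signed_measure =
  fixes M :: "'z measure" and \<sigma> :: "'z set \<Rightarrow> real"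
  assumes countably_additive:
    "\<And>A :: nat \<Rightarrow> 'z set. range A \<subseteq> sets M \<Longrightarrow> disjoint_family A \<Longrightarrow> (\<lambda>n. \<sigma> (A n)) sums \<sigma> (\<Union>n. A n)"
begin

lemma measure_empty: "\<sigma> {} = 0"
proof -
  have "(\<lambda>n::nat. \<sigma> {}) sums \<sigma> {}"
    using countably_additive[of "\<lambda>_. {}"] by (simp add: disjoint_family_on_def)
  then show ?thesis
    by (metis sums_summable summable_const_iff)
qed

lemma measure_Un:
  assumes "A \<in> sets M" "B \<in> sets M" "A \<inter> B = {}"
  shows "\<sigma> (A \<union> B) = \<sigma> A + \<sigma> B"
proof -
  have "disjoint_family (binaryset A B)"
    using assms(3) by (auto simp: disjoint_family_on_def binaryset_def)
  then have "(\<lambda>n. \<sigma> (binaryset A B n)) sums \<sigma> (A \<union> B)"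
    using countably_additive[of "binaryset A B"] assms
    by (simp add: range_binaryset_eq UN_binaryset_eq)
  moreover have "(\<lambda>n. \<sigma> (binaryset A B n)) sums (\<sigma> A + \<sigma> B)"
    by (rule binaryset_sums) (rule measure_empty)
  ultimately show ?thesis
    by (rule sums_unique2)
qed

lemma measure_split:
  assumes "A \<in> sets M" "B \<in> sets M"
  shows "\<sigma> A = \<sigma> (A \<inter> B) + \<sigma> (A - B)"
  using measure_Un[of "A \<inter> B" "A - B"] assms by (simp add: Int_Diff_disjoint Int_Diff_Un)

text \<open>
  If the values were unbounded, a set on which they are unbounded could always be split in two parts
  of measure at least \<open>1\<close> in absolute value, on one of which they are still unbounded. Discarding
  the other part and repeating would give disjoint sets whose measures do not tend to \<open>0\<close>.
\<close>

lemma measure_bounded: "\<exists>C. \<forall>B\<in>sets M. \<bar>\<sigma> B\<bar> \<le> C"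
proof (rule ccontr)
  define unbounded where
    "unbounded X \<longleftrightarrow> X \<in> sets M \<and> (\<forall>C. \<exists>B\<in>sets M. B \<subseteq> X \<and> C < \<bar>\<sigma> B\<bar>)" for X
  assume *: "\<not> ?thesis"
  have "\<exists>B\<in>sets M. B \<subseteq> space M \<and> C < \<bar>\<sigma> B\<bar>" for C
    using * sets.sets_into_space by (metis not_le)
  then have "unbounded (space M)"
    by (simp add: unbounded_def)
  have step: "\<exists>Y. unbounded Y \<and> Y \<subseteq> X \<and> 1 \<le> \<bar>\<sigma> (X - Y)\<bar>" if X: "unbounded X" for X
  proof -
    obtain B where B: "B \<in> sets M" "B \<subseteq> X" "\<bar>\<sigma> X\<bar> + 1 < \<bar>\<sigma> B\<bar>"
      using X unfolding unbounded_def by blast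
    have "\<sigma> X = \<sigma> B + \<sigma> (X - B)"
      using measure_split[of X B] B X by (simp add: unbounded_def Int_absorb1)
    then have big: "1 \<le> \<bar>\<sigma> B\<bar>" "1 \<le> \<bar>\<sigma> (X - B)\<bar>"
      using B(3) by linarith+
    have "unbounded B \<or> unbounded (X - B)"
    proof (rule ccontr)
      assume *: "\<not> ?thesis"
      have "X - B \<in> sets M"
        using B X by (auto simp: unbounded_def)
      with * B(1) obtain C1 C2 where C: "\<And>D. D \<in> sets M \<Longrightarrow> D \<subseteq> B \<Longrightarrow> \<bar>\<sigma> D\<bar> \<le> C1"
        "\<And>D. D \<in> sets M \<Longrightarrow> D \<subseteq> X - B \<Longrightarrow> \<bar>\<sigma> D\<bar> \<le> C2"
        unfolding unbounded_def by (metis not_less)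
      obtain D where D: "D \<in> sets M" "D \<subseteq> X" "C1 + C2 < \<bar>\<sigma> D\<bar>"
        using X unfolding unbounded_def by blast
      have "\<bar>\<sigma> (D \<inter> B)\<bar> \<le> C1" "\<bar>\<sigma> (D - B)\<bar> \<le> C2"
        using B D by (auto intro!: C)
      with D(3) measure_split[OF D(1) B(1)] show False
        by linarith
    qed
    moreover have "X - (X - B) = B"
      using B(2) by blast
    ultimately show ?thesis
      using B(2) big by (metis Diff_subset)
  qed
  have "\<exists>X. \<forall>n. unbounded (X n) \<and> X (Suc n) \<subseteq> X n \<and> 1 \<le> \<bar>\<sigma> (X n - X (Suc n))\<bar>"
    by (rule dependent_nat_choice) (use \<open>unbounded (space M)\<close> step in auto)
  then obtain X where X: "\<And>n. unbounded (X n)" "\<And>n. X (Suc n) \<subseteq> X n"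
    "\<And>n. 1 \<le> \<bar>\<sigma> (X n - X (Suc n))\<bar>"
    by blast
  have anti: "X n \<subseteq> X m" if "m \<le> n" for m n
    using lift_Suc_antimono_le[of X] X(2) that by blast
  have "disjoint_family (\<lambda>n. X n - X (Suc n))"
    unfolding disjoint_family_on_def
  proof (intro ballI impI)
    fix m n :: nat assume "m \<noteq> n"
    then show "(X m - X (Suc m)) \<inter> (X n - X (Suc n)) = {}"
      using anti[of "Suc m" n] anti[of "Suc n" m] by (cases "m < n") auto
  qed
  then have "(\<lambda>n. \<sigma> (X n - X (Suc n))) sums \<sigma> (\<Union>n. X n - X (Suc n))"
    using X(1) by (intro countably_additive) (auto simp: unbounded_def)
  then have "(\<lambda>n. \<sigma> (X n - X (Suc n))) \<longlonglongrightarrow> 0"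
    by (intro summable_LIMSEQ_zero sums_summable)
  then obtain N where "\<bar>\<sigma> (X N - X (Suc N))\<bar> < 1"
    using LIMSEQ_D[of _ 0 1] by fastforce
  with X(3)[of N] show False
    by linarith
qed

text \<open>
  On measurable sets this is the positive part \<open>\<sigma>\<^sup>+\<close> of the Jordan decomposition.
\<close>

definition upper_variation :: "'z set \<Rightarrow> real" where
  "upper_variation A = Sup (\<sigma> ` {B\<in>sets M. B \<subseteq> A})"

lemma le_upper_variation:
  assumes "B \<in> sets M" "B \<subseteq> A"
  shows "\<sigma> B \<le> upper_variation A"
proof -
  obtain C where "\<And>B. B \<in> sets M \<Longrightarrow> \<bar>\<sigma> B\<bar> \<le> C"
    using measure_bounded by blast
  then have "bdd_above (\<sigma> ` {B\<in>sets M. B \<subseteq> A})"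
    by (intro bdd_aboveI[of _ C]) (auto simp: abs_le_iff)
  then show ?thesis
    unfolding upper_variation_def using assms by (intro cSup_upper) auto
qed

lemma upper_variation_le:
  assumes "\<And>B. B \<in> sets M \<Longrightarrow> B \<subseteq> A \<Longrightarrow> \<sigma> B \<le> C"
  shows "upper_variation A \<le> C"
  unfolding upper_variation_def by (rule cSup_least) (use assms in auto)

lemma upper_variation_nonneg: "0 \<le> upper_variation A"
  using le_upper_variation[of "{}" A] by (simp add: measure_empty)

lemma upper_variation_mono: "A \<subseteq> B \<Longrightarrow> upper_variation A \<le> upper_variation B"
  by (intro upper_variation_le le_upper_variation) auto

lemma upper_variation_superadditive:
  assumes "A \<inter> B = {}"
  shows "upper_variation A + upper_variation B \<le> upper_variation (A \<union> B)"
proof -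
  have *: "\<sigma> C + \<sigma> D \<le> upper_variation (A \<union> B)"
    if "C \<in> sets M" "C \<subseteq> A" "D \<in> sets M" "D \<subseteq> B" for C D
  proof -
    have "\<sigma> C + \<sigma> D = \<sigma> (C \<union> D)"
      using that assms by (intro measure_Un[symmetric]) auto
    also have "\<dots> \<le> upper_variation (A \<union> B)"
      using that by (intro le_upper_variation) auto
    finally show ?thesis .
  qed
  have "upper_variation A \<le> upper_variation (A \<union> B) - \<sigma> D" if "D \<in> sets M" "D \<subseteq> B" for D
  proof (rule upper_variation_le)
    fix C assume "C \<in> sets M" "C \<subseteq> A"
    from *[OF this that] show "\<sigma> C \<le> upper_variation (A \<union> B) - \<sigma> D"
      by linarith
  qed
  then have "\<sigma> D \<le> upper_variation (A \<union> B) - upper_variation A" if "D \<in> sets M" "D \<subseteq> B" for D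
    using that by (metis le_diff_eq add.commute)
  then have "upper_variation B \<le> upper_variation (A \<union> B) - upper_variation A"
    by (rule upper_variation_le)
  then show ?thesis
    by linarith
qed

text \<open>
  The lower bound for the value on the union is superadditivity; the upper bound holds because any
  measurable subset \<open>B\<close> of the union is cut by the sets \<open>A n\<close> into pieces whose measures add up to \<open>\<sigma> B\<close>.
\<close>

lemma upper_variation_sums:
  fixes A :: "nat \<Rightarrow> 'z set"
  assumes A: "range A \<subseteq> sets M" "disjoint_family A"
  shows "(\<lambda>n. upper_variation (A n)) sums upper_variation (\<Union>n. A n)"
proof -
  have partial: "(\<Sum>n<N. upper_variation (A n)) \<le> upper_variation (\<Union>n. A n)" for N
  proof -
    have "(\<Sum>n<N. upper_variation (A n)) \<le> upper_variation (\<Union>n<N. A n)"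
    proof (induction N)
      case 0
      then show ?case
        by (simp add: upper_variation_nonneg)
    next
      case (Suc N)
      have "(\<Union>n<N. A n) \<inter> A N = {}"
        using A(2) by (auto simp: disjoint_family_on_def) (metis IntI empty_iff less_irrefl)
      from upper_variation_superadditive[OF this] Suc show ?case
        by (simp add: lessThan_Suc Un_commute)
    qed
    also have "\<dots> \<le> upper_variation (\<Union>n. A n)"
      by (rule upper_variation_mono) auto
    finally show ?thesis .
  qed
  have summable: "summable (\<lambda>n. upper_variation (A n))"
    by (rule bounded_imp_summable[OF upper_variation_nonneg])
      (use partial[of "Suc n" for n] in \<open>simp only: lessThan_Suc_atMost\<close>)
  have "upper_variation (\<Union>n. A n) \<le> (\<Sum>n. upper_variation (A n))"
  proof (rule upper_variation_le)
    fix B assume B: "B \<in> sets M" "B \<subseteq> (\<Union>n. A n)"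
    have "(\<lambda>n. \<sigma> (B \<inter> A n)) sums \<sigma> (\<Union>n. B \<inter> A n)"
      using A B by (intro countably_additive) (auto simp: disjoint_family_on_def)
    moreover have "(\<Union>n. B \<inter> A n) = B"
      using B by blast
    ultimately have "(\<lambda>n. \<sigma> (B \<inter> A n)) sums \<sigma> B"
      by simp
    then show "\<sigma> B \<le> (\<Sum>n. upper_variation (A n))"
      by (rule sums_le[rotated, OF _ summable_sums[OF summable]])
        (use A B in \<open>auto intro!: le_upper_variation\<close>)
  qed
  moreover have "(\<Sum>n. upper_variation (A n)) \<le> upper_variation (\<Union>n. A n)"
    by (rule suminf_le_const[OF summable partial])
  ultimately have "(\<Sum>n. upper_variation (A n)) = upper_variation (\<Union>n. A n)"
    by linarith
  with summable_sums[OF summable] show ?thesis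
    by simp
qed

lemma nonneg_imp_finite_measure:
  assumes nonneg: "\<And>A. A \<in> sets M \<Longrightarrow> 0 \<le> \<sigma> A"
  obtains N where "finite_measure N" "sets N = sets M" "\<And>A. A \<in> sets M \<Longrightarrow> measure N A = \<sigma> A"
proof -
  define N where "N = measure_of (space M) (sets M) (\<lambda>A. ennreal (\<sigma> A))"
  have sets: "sets N = sets M" and space: "space N = space M"
    by (simp_all add: N_def sets.space_closed sets.sigma_sets_eq space_measure_of_conv)
  have emeasure: "emeasure N A = ennreal (\<sigma> A)" if "A \<in> sets M" for A
  proof (rule emeasure_measure_of[OF N_def])
    show "sets M \<subseteq> Pow (space M)"
      by (rule sets.space_closed)
    show "positive (sets N) (\<lambda>A. ennreal (\<sigma> A))"
      by (simp add: positive_def measure_empty)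
    show "Sigma_Algebra.countably_additive (sets N) (\<lambda>A. ennreal (\<sigma> A))"
    proof (rule countably_additiveI)
      fix A :: "nat \<Rightarrow> 'z set"
      assume A: "range A \<subseteq> sets N" "disjoint_family A"
      then have "(\<lambda>n. \<sigma> (A n)) sums \<sigma> (\<Union>n. A n)"
        by (intro countably_additive) (auto simp: sets)
      with A show "(\<Sum>i. ennreal (\<sigma> (A i))) = ennreal (\<sigma> (\<Union>i. A i))"
        by (intro suminf_ennreal_eq nonneg) (auto simp: sets)
    qed
  qed (use that sets in auto)
  show ?thesis
  proof (rule that)
    show "finite_measure N"
      by (rule finite_measureI) (simp add: space emeasure)
    show "measure N A = \<sigma> A" if "A \<in> sets M" for A
      using emeasure[OF that] nonneg[OF that] by (simp add: measure_def)
  qed (rule sets)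
qed

end

lemma signed_measure_finite_measure:
  assumes "finite_measure N" "sets N = sets M"
  shows "signed_measure M (measure N)"
proof
  interpret finite_measure N by fact
  fix A :: "nat \<Rightarrow> 'a set"
  assume "range A \<subseteq> sets M" "disjoint_family A"
  then show "(\<lambda>n. measure N (A n)) sums measure N (\<Union>n. A n)"
    using assms by (intro finite_measure_UNION) auto
qed

lemma signed_measure_add:
  assumes "signed_measure M \<sigma>" "signed_measure M \<tau>"
  shows "signed_measure M (\<lambda>A. \<sigma> A + \<tau> A)"
  by standard (intro sums_add assms[THEN signed_measure.countably_additive])

lemma signed_measure_diff:
  assumes "signed_measure M \<sigma>" "signed_measure M \<tau>"
  shows "signed_measure M (\<lambda>A. \<sigma> A - \<tau> A)"
  by standard (intro sums_diff assms[THEN signed_measure.countably_additive])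

text \<open>
  The difference \<open>\<sigma>\<^sup>+ - \<sigma>\<close> is nonnegative because \<open>A\<close> is one of the sets in the supremum \<open>\<sigma>\<^sup>+ A\<close>.
\<close>

lemma Jordan_decomposition:
  assumes "signed_measure M \<sigma>"
  obtains P N where "finite_measure P" "sets P = sets M" "finite_measure N" "sets N = sets M"
    "\<And>A. A \<in> sets M \<Longrightarrow> \<sigma> A = measure P A - measure N A"
proof -
  interpret signed_measure M \<sigma> by fact
  have up: "signed_measure M upper_variation"
    by standard (rule upper_variation_sums)
  obtain P where P: "finite_measure P" "sets P = sets M"
    "\<And>A. A \<in> sets M \<Longrightarrow> measure P A = upper_variation A"
    using upper_variation_nonneg by (rule signed_measure.nonneg_imp_finite_measure[OF up]) (rule that)
  have "0 \<le> upper_variation A - \<sigma> A" if "A \<in> sets M" for A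
    using le_upper_variation[OF that] by simp
  then obtain N where N: "finite_measure N" "sets N = sets M"
    "\<And>A. A \<in> sets M \<Longrightarrow> measure N A = upper_variation A - \<sigma> A"
    by (rule signed_measure.nonneg_imp_finite_measure[OF signed_measure_diff[OF up assms]])
      (assumption, rule that)
  show ?thesis
    by (rule that[OF P(1,2) N(1,2)]) (simp add: P N)
qed

text \<open>
  The Radon--Nikodym theorem with a real density, as needed for combining densities linearly.
\<close>

lemma finite_measure_density:
  assumes "finite_measure L" "finite_measure N" "sets N = sets L"
    and ac: "\<And>A. A \<in> sets L \<Longrightarrow> measure L A = 0 \<Longrightarrow> measure N A = 0"
  obtains g :: "_ \<Rightarrow> real" where "integrable L g"
    "\<And>A. A \<in> sets L \<Longrightarrow> measure N A = (\<integral>x. indicator A x * g x \<partial>L)"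
proof -
  interpret L: finite_measure L by fact
  interpret N: finite_measure N by fact
  have "absolutely_continuous L N"
    unfolding absolutely_continuous_def null_sets_def using assms(3) ac
    by (auto simp: L.emeasure_eq_measure N.emeasure_eq_measure)
  note RN = N.sigma_finite_measure_axioms this assms(3)
  define g where "g = (\<lambda>x. enn2real (RN_deriv L N x))"
  have space: "space N = space L"
    by (rule sets_eq_imp_space_eq) (rule assms(3))
  have "integrable N (\<lambda>_. 1 :: real)"
    by simp
  then have int: "integrable L g"
    by (subst (asm) L.RN_deriv_integrable[OF RN]) (auto simp: g_def)
  have "measure N A = (\<integral>x. indicator A x * g x \<partial>L)" if A: "A \<in> sets L" for A
  proof -
    have "measure N A = integral\<^sup>L N (indicator A)"
      using A assms(3) sets.sets_into_space[of A N] by (simp add: Int_absorb2)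
    also have "\<dots> = (\<integral>x. g x * indicator A x \<partial>L)"
      unfolding g_def by (rule L.RN_deriv_integral[OF RN]) (use A in simp)
    finally show ?thesis
      by (simp add: mult.commute)
  qed
  with int show ?thesis
    using that by blast
qed

text \<open>
  The modulus of the density goes into the measure and its phase becomes the function \<open>h\<close>. On the
  zeros of \<open>g\<close>, a null set for the new measure, the phase is set to \<open>1\<close> to be unimodular everywhere.
\<close>

lemma polar_decomp_density:
  fixes L :: "'z::topological_space measure" and g :: "'z \<Rightarrow> complex"
  assumes L: "sets L = sets borel" and g: "integrable L g"
    and \<mu>: "\<And>A. A \<in> sets borel \<Longrightarrow> \<mu> A = (\<integral>x. indicator A x *\<^sub>R g x \<partial>L)"
  shows "polar_decomp \<mu> (density L (\<lambda>x. cmod (g x))) (\<lambda>x. if g x = 0 then 1 else sgn (g x))"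
proof -
  have [measurable]: "g \<in> borel_measurable L"
    using g by simp
  have gb[measurable]: "g \<in> borel_measurable borel"
    using measurable_cong_sets[OF L refl, of "borel :: complex measure"] \<open>g \<in> borel_measurable L\<close> by simp
  have sgn[measurable]: "(\<lambda>x. sgn (g x)) \<in> borel_measurable borel"
    unfolding sgn_eq by measurable
  define h where "h x = (if g x = 0 then 1 else sgn (g x))" for x
  have h: "h \<in> borel_measurable borel"
    unfolding h_def by measurable
  then have hL[measurable]: "h \<in> borel_measurable L"
    using measurable_cong_sets[OF L refl, of "borel :: complex measure"] by simp
  have gh: "cmod (g x) *\<^sub>R h x = g x" for x
    by (auto simp: h_def sgn_eq scaleR_conv_of_real)
  have "finite_measure (density L (\<lambda>x. cmod (g x)))"
  proof (rule finite_measureI)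
    have "(\<integral>\<^sup>+x. ennreal (cmod (g x)) \<partial>L) < \<infinity>"
      using g by (simp add: integrable_iff_bounded)
    moreover have "emeasure (density L (\<lambda>x. cmod (g x))) (space L) = (\<integral>\<^sup>+x. ennreal (cmod (g x)) \<partial>L)"
      by (subst emeasure_density) (auto intro!: nn_integral_cong)
    ultimately show "emeasure (density L (\<lambda>x. cmod (g x))) (space (density L (\<lambda>x. cmod (g x)))) \<noteq> \<infinity>"
      by simp
  qed
  moreover have "\<mu> A = (\<integral>x\<in>A. h x \<partial>density L (\<lambda>x. cmod (g x)))" if A: "A \<in> sets borel" for A
  proof -
    have [measurable]: "A \<in> sets L"
      using A L by simp
    have "(\<integral>x\<in>A. h x \<partial>density L (\<lambda>x. cmod (g x)))
        = (\<integral>x. cmod (g x) *\<^sub>R (indicator A x *\<^sub>R h x) \<partial>L)"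
      unfolding set_lebesgue_integral_def by (rule integral_density) auto
    also have "\<dots> = (\<integral>x. indicator A x *\<^sub>R g x \<partial>L)"
      by (intro Bochner_Integration.integral_cong refl)
        (subst scaleR_left_commute, simp only: gh)
    finally show ?thesis
      using \<mu>[OF A] by simp
  qed
  ultimately have "polar_decomp \<mu> (density L (\<lambda>x. cmod (g x))) h"
    using L h by (simp add: polar_decomp_def) (simp add: h_def norm_sgn)
  then show ?thesis
    unfolding h_def .
qed

lemma polar_decomp_exists:
  fixes \<mu> :: "'z::topological_space set \<Rightarrow> complex"
  assumes "complex_measure \<mu>"
  shows "\<exists>\<nu> h. polar_decomp \<mu> \<nu> h"
proof -
  let ?B = "borel :: 'z measure"
  have Re: "signed_measure ?B (\<lambda>A. Re (\<mu> A))" and Im: "signed_measure ?B (\<lambda>A. Im (\<mu> A))"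
    by (standard; use assms in \<open>auto simp: complex_measure_def intro!: sums_Re sums_Im\<close>)+
  obtain P1 N1 where 1: "finite_measure P1" "sets P1 = sets ?B" "finite_measure N1" "sets N1 = sets ?B"
    "\<And>A. A \<in> sets ?B \<Longrightarrow> Re (\<mu> A) = measure P1 A - measure N1 A"
    using Jordan_decomposition[OF Re] by metis
  obtain P2 N2 where 2: "finite_measure P2" "sets P2 = sets ?B" "finite_measure N2" "sets N2 = sets ?B"
    "\<And>A. A \<in> sets ?B \<Longrightarrow> Im (\<mu> A) = measure P2 A - measure N2 A"
    using Jordan_decomposition[OF Im] by metis
  \<comment> \<open>A finite measure with respect to which all four parts have densities.\<close>
  obtain L where L: "finite_measure L" "sets L = sets ?B"
    "\<And>A. A \<in> sets ?B \<Longrightarrow> measure L A = measure P1 A + measure N1 A + (measure P2 A + measure N2 A)"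
  proof (rule signed_measure.nonneg_imp_finite_measure)
    show "signed_measure ?B (\<lambda>A. measure P1 A + measure N1 A + (measure P2 A + measure N2 A))"
      by (intro signed_measure_add signed_measure_finite_measure 1 2)
  qed auto
  have zero: "measure P1 A = 0" "measure N1 A = 0" "measure P2 A = 0" "measure N2 A = 0"
    if "A \<in> sets L" "measure L A = 0" for A
  proof -
    have "measure P1 A + measure N1 A + (measure P2 A + measure N2 A) = 0"
      using L(3)[of A] that by (simp add: L(2))
    then show "measure P1 A = 0" "measure N1 A = 0" "measure P2 A = 0" "measure N2 A = 0"
      using measure_nonneg[of P1 A] measure_nonneg[of N1 A] measure_nonneg[of P2 A]
        measure_nonneg[of N2 A] by linarith+
  qed
  obtain p1 where p1: "integrable L p1" "\<And>A. A \<in> sets L \<Longrightarrow> measure P1 A = (\<integral>x. indicator A x * p1 x \<partial>L)"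
    using finite_measure_density[OF L(1) 1(1)] zero(1) 1(2) L(2) by metis
  obtain n1 where n1: "integrable L n1" "\<And>A. A \<in> sets L \<Longrightarrow> measure N1 A = (\<integral>x. indicator A x * n1 x \<partial>L)"
    using finite_measure_density[OF L(1) 1(3)] zero(2) 1(4) L(2) by metis
  obtain p2 where p2: "integrable L p2" "\<And>A. A \<in> sets L \<Longrightarrow> measure P2 A = (\<integral>x. indicator A x * p2 x \<partial>L)"
    using finite_measure_density[OF L(1) 2(1)] zero(3) 2(2) L(2) by metis
  obtain n2 where n2: "integrable L n2" "\<And>A. A \<in> sets L \<Longrightarrow> measure N2 A = (\<integral>x. indicator A x * n2 x \<partial>L)"
    using finite_measure_density[OF L(1) 2(3)] zero(4) 2(4) L(2) by metis
  define g where "g x = complex_of_real (p1 x - n1 x) + \<i> * complex_of_real (p2 x - n2 x)" for x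
  have g: "integrable L g"
    unfolding g_def using p1 n1 p2 n2 by (intro Bochner_Integration.integrable_add integrable_mult_right
        integrable_of_real Bochner_Integration.integrable_diff) auto
  have "\<mu> A = (\<integral>x. indicator A x *\<^sub>R g x \<partial>L)" if A: "A \<in> sets borel" for A
  proof (rule complex_eqI)
    have [measurable]: "A \<in> sets L"
      using A L(2) by simp
    have int: "integrable L (\<lambda>x. indicator A x *\<^sub>R g x)"
      by (rule integrable_mult_indicator[OF _ g]) simp
    have ind: "integrable L (\<lambda>x. indicator A x * f x)" if "integrable L f" for f :: "'z \<Rightarrow> real"
      using integrable_mult_indicator[OF \<open>A \<in> sets L\<close> that] by simp
    have "Re (\<mu> A) = (\<integral>x. indicator A x * p1 x - indicator A x * n1 x \<partial>L)"
      using A p1 n1 by (simp add: 1(5) L(2) ind)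
    also have "\<dots> = (\<integral>x. Re (indicator A x *\<^sub>R g x) \<partial>L)"
      by (intro Bochner_Integration.integral_cong refl) (simp add: g_def right_diff_distrib)
    finally show "Re (\<mu> A) = Re (\<integral>x. indicator A x *\<^sub>R g x \<partial>L)"
      by (simp only: integral_Re[OF int])
    have "Im (\<mu> A) = (\<integral>x. indicator A x * p2 x - indicator A x * n2 x \<partial>L)"
      using A p2 n2 by (simp add: 2(5) L(2) ind)
    also have "\<dots> = (\<integral>x. Im (indicator A x *\<^sub>R g x) \<partial>L)"
      by (intro Bochner_Integration.integral_cong refl) (simp add: g_def right_diff_distrib)
    finally show "Im (\<mu> A) = Im (\<integral>x. indicator A x *\<^sub>R g x \<partial>L)"
      by (simp only: integral_Im[OF int])
  qed
  from polar_decomp_density[OF L(2) g this] show ?thesis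
    by blast
qed

text \<open>
  Every statement about \<open>cm_integral\<close> reduces to the polar decomposition chosen in its definition;
  the existence result makes that choice a genuine one.
\<close>

lemma cm_integral_polar:
  fixes \<mu> :: "'z::topological_space set \<Rightarrow> complex"
  assumes "complex_measure \<mu>"
  obtains \<nu> h where "polar_decomp \<mu> \<nu> h" "\<And>F. cm_integral \<mu> F = (\<integral>z. F z * h z \<partial>\<nu>)"
proof -
  define p where "p = (SOME (\<nu>, h). polar_decomp \<mu> \<nu> h)"
  have "\<exists>p. case p of (\<nu>, h) \<Rightarrow> polar_decomp \<mu> \<nu> h"
    using polar_decomp_exists[OF assms] by auto
  then have "case p of (\<nu>, h) \<Rightarrow> polar_decomp \<mu> \<nu> h"
    unfolding p_def by (rule someI_ex)
  moreover have "cm_integral \<mu> F = (case p of (\<nu>, h) \<Rightarrow> \<integral>z. F z * h z \<partial>\<nu>)" for F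
    by (simp add: cm_integral_def p_def)
  ultimately show ?thesis
    using that[of "fst p" "snd p"] by (simp add: case_prod_unfold)
qed

section \<open>The weak integral of the translates of an operator\<close>

text \<open>
  As a function of \<open>z\<close>, the inner product is an integral with a jointly measurable integrand, so it is
  measurable by the measurability part of Fubini's theorem.
\<close>

lemma borel_measurable_cinner_tf_shift:
  fixes \<psi> \<phi> :: "'a::euclidean_space l2"
  shows "(\<lambda>z. cinner (tf_shift z \<psi>) \<phi>) \<in> borel_measurable borel"
proof transfer
  fix f g :: "'a \<Rightarrow> complex"
  assume "l2_rel f f" "l2_rel g g"
  then have [measurable]: "f \<in> borel_measurable borel" "g \<in> borel_measurable borel"
    by (auto simp: l2_rel_def sq_integrable_def)
  have [measurable]: "(exp :: complex \<Rightarrow> complex) \<in> borel_measurable borel"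
    by (intro borel_measurable_continuous_onI continuous_intros)
  have "(\<lambda>z. \<integral>t. exp (2 * of_real pi * \<i> * of_real (snd z \<bullet> t)) * f (t - fst z) * cnj (g t) \<partial>lborel)
      \<in> borel_measurable (borel \<Otimes>\<^sub>M borel)"
    by measurable
  then show "(\<lambda>z. \<integral>t. (case z of (x, \<omega>) \<Rightarrow>
      \<lambda>\<psi> t. exp (2 * of_real pi * \<i> * of_real (\<omega> \<bullet> t)) * \<psi> (t - x)) f t * cnj (g t) \<partial>lborel)
      \<in> borel_measurable borel"
    by (simp add: borel_prod case_prod_unfold)
qed

text \<open>
  Inserting the singular value decomposition of \<open>S\<close> exhibits the function as a pointwise limit of
  sums of products of the functions \<open>\<langle>\<pi>(z) (f n), \<phi>\<rangle>\<close> and conjugates of \<open>\<langle>\<pi>(z) (e n), \<psi>\<rangle>\<close>.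
\<close>

lemma borel_measurable_cinner_shift_op:
  fixes S :: "'a::euclidean_space op"
  assumes S: "singular_value_decomp S s e f"
  shows "(\<lambda>z. cinner (shift_op z S \<psi>) \<phi>) \<in> borel_measurable borel"
proof (rule borel_measurable_LIMSEQ_metric)
  let ?c = "\<lambda>n z. of_real (s n) * cnj (cinner (tf_shift z (e n)) \<psi>) * cinner (tf_shift z (f n)) \<phi>"
  show "(\<lambda>z. \<Sum>n<N. ?c n z) \<in> borel_measurable borel" for N
    using borel_measurable_cinner_tf_shift by measurable
  show "(\<lambda>N. \<Sum>n<N. ?c n z) \<longlonglongrightarrow> cinner (shift_op z S \<psi>) \<phi>" for z
  proof -
    have "cinner (adj (tf_shift z) \<psi>) (e n) = cnj (cinner (tf_shift z (e n)) \<psi>)" for n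
      by (simp add: cinner_adj_left[OF bounded_op_tf_shift] cinner_commute[symmetric])
    then show ?thesis
      using singular_value_decomp_cinner_sums[OF S, of "adj (tf_shift z) \<psi>" "adj (tf_shift z) \<phi>"]
      by (simp add: sums_def cinner_adj[OF bounded_op_tf_shift])
  qed
qed

lemma cmod_cinner_shift_op_le:
  assumes "K \<ge> 0" "\<And>x. norm (S x) \<le> K * norm x"
  shows "cmod (cinner (shift_op z S \<psi>) \<phi>) \<le> K * norm \<psi> * norm \<phi>"
  using cinner_Cauchy_Schwarz[of "shift_op z S \<psi>" \<phi>]
    mult_right_mono[OF norm_shift_op_le[OF assms, of z \<psi>] norm_ge_zero[of \<phi>]] by linarith

lemma shift_op_linear:
  assumes "bounded_op S"
  shows "shift_op z S (x + y) = shift_op z S x + shift_op z S y"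
    "shift_op z S (scaleC c x) = scaleC c (shift_op z S x)"
proof -
  have S: "S (u + v) = S u + S v" "S (scaleC c u) = scaleC c (S u)" for u v
    using assms by (auto simp: bounded_op_def linear_add[OF bounded_linear.linear])
  have adj: "adj (tf_shift z) (x + y) = adj (tf_shift z) x + adj (tf_shift z) y"
    "adj (tf_shift z) (scaleC c x) = scaleC c (adj (tf_shift z) x)"
    by (rule cinner_eqI; simp add: cinner_adj_left[OF bounded_op_tf_shift] cinner_add_left
        cinner_scaleC_left)+
  show "shift_op z S (x + y) = shift_op z S x + shift_op z S y"
    "shift_op z S (scaleC c x) = scaleC c (shift_op z S x)"
    by (simp_all add: S adj tf_shift_add tf_shift_scaleC)
qed

text \<open>
  The integral of \<open>\<langle>\<pi>(z) S \<pi>(z)\<^sup>* \<psi>, \<phi>\<rangle>\<close> is a bounded sesquilinear form in \<open>\<psi>\<close> and \<open>\<phi>\<close>, hence is given by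
  a bounded operator.
\<close>

lemma weak_integral_shift_op:
  fixes S :: "'a::euclidean_space op"
  assumes S: "singular_value_decomp S s e f" and \<mu>: "polar_decomp \<mu> \<nu> h"
  obtains B where "bounded_op B"
    "\<And>\<psi> \<phi>. cinner (B \<psi>) \<phi> = (\<integral>z. cinner (shift_op z S \<psi>) \<phi> * h z \<partial>\<nu>)"
proof -
  have S': "bounded_op S"
    by (rule singular_value_decomp_bounded_op[OF S])
  obtain K where K: "K \<ge> 0" "\<And>x. norm (S x) \<le> K * norm x"
    using bounded_op_norm_bound[OF S'] by metis
  interpret finite_measure \<nu>
    using \<mu> by (simp add: polar_decomp_def)
  have h: "cmod (h z) = 1" for z
    using \<mu> unfolding polar_decomp_def by blast
  define F where "F \<psi> \<phi> z = cinner (shift_op z S \<psi>) \<phi> * h z" for \<psi> \<phi> z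
  define I where "I \<psi> \<phi> = (\<integral>z. F \<psi> \<phi> z \<partial>\<nu>)" for \<psi> \<phi>
  define C where "C = measure \<nu> (space \<nu>) * K"
  have "C \<ge> 0"
    using K(1) by (simp add: C_def)
  have bound: "cmod (F \<psi> \<phi> z) \<le> K * norm \<psi> * norm \<phi>" for \<psi> \<phi> z
    using cmod_cinner_shift_op_le[OF K, of z \<psi> \<phi>] by (simp add: F_def norm_mult h)
  have int: "integrable \<nu> (F \<psi> \<phi>)" for \<psi> \<phi>
  proof (rule integrable_const_bound[where B = "K * norm \<psi> * norm \<phi>"])
    have "F \<psi> \<phi> \<in> borel_measurable borel"
      unfolding F_def using \<mu> borel_measurable_cinner_shift_op[OF S]
      by (intro borel_measurable_times) (auto simp: polar_decomp_def)
    then show "F \<psi> \<phi> \<in> borel_measurable \<nu>"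
      using \<mu> by (simp add: polar_decomp_def cong: measurable_cong_sets)
  qed (intro AE_I2 bound)
  have I_le: "cmod (I \<psi> \<phi>) \<le> C * norm \<psi> * norm \<phi>" for \<psi> \<phi>
  proof -
    have "cmod (I \<psi> \<phi>) \<le> (\<integral>z. cmod (F \<psi> \<phi> z) \<partial>\<nu>)"
      unfolding I_def by (rule integral_norm_bound)
    also have "\<dots> \<le> (\<integral>z. K * norm \<psi> * norm \<phi> \<partial>\<nu>)"
      using int by (intro integral_mono bound integrable_norm) auto
    finally show ?thesis
      by (simp add: C_def mult_ac)
  qed
  have I_simps: "I (\<psi> + \<psi>') \<phi> = I \<psi> \<phi> + I \<psi>' \<phi>" "I (scaleC c \<psi>) \<phi> = c * I \<psi> \<phi>"
    "I \<psi> (\<phi> + \<phi>') = I \<psi> \<phi> + I \<psi> \<phi>'" "I \<psi> (scaleC c \<phi>) = cnj c * I \<psi> \<phi>" for \<psi> \<psi>' \<phi> \<phi>' c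
  proof -
    have "F (\<psi> + \<psi>') \<phi> = (\<lambda>z. F \<psi> \<phi> z + F \<psi>' \<phi> z)"
      "F \<psi> (\<phi> + \<phi>') = (\<lambda>z. F \<psi> \<phi> z + F \<psi> \<phi>' z)"
      "F (scaleC c \<psi>) \<phi> = (\<lambda>z. c * F \<psi> \<phi> z)" "F \<psi> (scaleC c \<phi>) = (\<lambda>z. cnj c * F \<psi> \<phi> z)"
      unfolding F_def shift_op_linear[OF S'] fun_eq_iff
      by (simp_all only: simp_thms cinner_add_left cinner_add_right cinner_scaleC_left cinner_scaleC_right
          distrib_right mult.assoc)
    then show "I (\<psi> + \<psi>') \<phi> = I \<psi> \<phi> + I \<psi>' \<phi>" "I (scaleC c \<psi>) \<phi> = c * I \<psi> \<phi>"
      "I \<psi> (\<phi> + \<phi>') = I \<psi> \<phi> + I \<psi> \<phi>'" "I \<psi> (scaleC c \<phi>) = cnj c * I \<psi> \<phi>"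
      unfolding I_def by (simp_all add: int)
  qed
  have "\<exists>w. \<forall>\<phi>. I \<psi> \<phi> = cinner w \<phi>" for \<psi>
  proof -
    have "bounded_linear (I \<psi>)"
    proof (rule bounded_linear_intro)
      show "norm (I \<psi> \<phi>) \<le> norm \<phi> * (C * norm \<psi>)" for \<phi>
        using I_le[of \<psi> \<phi>] by (simp add: mult_ac)
    qed (simp_all add: I_simps scaleR_l2_def scaleR_conv_of_real)
    then show ?thesis
      by (rule Riesz_representation) (auto simp: I_simps)
  qed
  then obtain B where B: "\<And>\<psi> \<phi>. I \<psi> \<phi> = cinner (B \<psi>) \<phi>"
    by metis
  have "bounded_op B"
  proof (rule bounded_opI)
    show "B (x + y) = B x + B y" for x y
      by (rule cinner_eqI) (simp add: B[symmetric] I_simps cinner_add_left)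
    show "B (scaleC c x) = scaleC c (B x)" for c x
      by (rule cinner_eqI) (simp add: B[symmetric] I_simps cinner_scaleC_left)
    show "norm (B x) \<le> C * norm x" for x
    proof (cases "B x = 0")
      case False
      have "norm (B x) * norm (B x) = cmod (cinner (B x) (B x))"
        by (simp add: cinner_eq_norm power2_eq_square norm_mult)
      also have "\<dots> \<le> C * norm x * norm (B x)"
        using I_le[of x "B x"] by (simp add: B)
      finally show ?thesis
        using False by simp
    qed (use \<open>C \<ge> 0\<close> in simp)
  qed
  then show ?thesis
    using that[of B] B by (simp add: I_def F_def)
qed

section \<open>Characterisation of the convolution by duality\<close>

text \<open>
  The weak integral \<open>B\<close> satisfies the duality relation defining \<open>\<mu> \<star> S\<close>. With the singular values \<open>r n\<close> and
  singular vectors \<open>a n\<close>, \<open>b n\<close> of \<open>R\<close>, both sides equal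
  \<open>\<Sum>n. r n * \<integral> \<langle>\<pi>(z) S \<pi>(z)\<^sup>* a n, b n\<rangle> d\<mu>(z)\<close>; integration and summation may be exchanged because the
  integrands are bounded by \<open>r n * K\<close>, with \<open>r\<close> summable and the total variation finite.
\<close>

lemma op_trace_comp_adj_weak_integral:
  fixes S B R :: "'a::euclidean_space op"
  assumes S: "singular_value_decomp S s e f" and \<mu>: "polar_decomp \<mu> \<nu> h"
    and B: "bounded_op B" "\<And>\<psi> \<phi>. cinner (B \<psi>) \<phi> = (\<integral>z. cinner (shift_op z S \<psi>) \<phi> * h z \<partial>\<nu>)"
    and R: "R \<in> schatten 1"
  shows "op_trace (B \<circ> adj R) = (\<integral>z. cnj (op_conv R (adj (check S)) z) * h z \<partial>\<nu>)"
proof -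
  obtain r a b where svd: "singular_value_decomp R r a b" and "summable (\<lambda>n. r n powr 1)"
    using R by (auto simp: schatten_def)
  then have r0: "\<And>n. r n \<ge> 0" and r: "summable r"
    and a: "orthonormal_on UNIV a" and b: "orthonormal_on UNIV b"
    by (simp_all add: singular_value_decomp_def orthonormal_seq_iff)
  have S': "bounded_op S"
    by (rule singular_value_decomp_bounded_op[OF S])
  obtain K where K: "K \<ge> 0" "\<And>x. norm (S x) \<le> K * norm x"
    using bounded_op_norm_bound[OF S'] by metis
  interpret finite_measure \<nu>
    using \<mu> by (simp add: polar_decomp_def)
  have h: "cmod (h z) = 1" for z
    using \<mu> unfolding polar_decomp_def by blast
  define F where "F n z = of_real (r n) * cinner (shift_op z S (a n)) (b n) * h z" for n z
  have F_sums: "(\<lambda>n. F n z) sums (cnj (op_conv R (adj (check S)) z) * h z)" for z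
    unfolding F_def by (intro sums_mult2 op_conv_adj_check[OF S' svd r])
  have bound: "norm (F n z) \<le> r n * K" for n z
    using cmod_cinner_shift_op_le[OF K, of z "a n" "b n"] r0[of n]
    by (auto simp: F_def norm_mult h norm_orthonormal[OF a] norm_orthonormal[OF b]
        intro!: mult_left_mono)
  have int: "integrable \<nu> (F n)" for n
  proof (rule integrable_const_bound[where B = "r n * K"])
    have "F n \<in> borel_measurable borel"
      unfolding F_def using \<mu> borel_measurable_cinner_shift_op[OF S]
      by (intro borel_measurable_times) (auto simp: polar_decomp_def)
    then show "F n \<in> borel_measurable \<nu>"
      using \<mu> by (simp add: polar_decomp_def cong: measurable_cong_sets)
  qed (intro AE_I2 bound)
  have "(\<lambda>n. \<integral>z. F n z \<partial>\<nu>) sums (\<integral>z. (\<Sum>n. F n z) \<partial>\<nu>)"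
  proof (rule sums_integral[OF int])
    show "AE z in \<nu>. summable (\<lambda>n. norm (F n z))"
      using bound by (intro AE_I2 summable_comparison_test'[OF summable_mult2[OF r, of K]]) auto
    have le: "(\<integral>z. norm (F n z) \<partial>\<nu>) \<le> r n * K * measure \<nu> (space \<nu>)" for n
    proof -
      have "(\<integral>z. norm (F n z) \<partial>\<nu>) \<le> (\<integral>z. r n * K \<partial>\<nu>)"
        using int by (intro integral_mono bound integrable_norm) auto
      then show ?thesis
        by (simp add: mult_ac)
    qed
    show "summable (\<lambda>n. \<integral>z. norm (F n z) \<partial>\<nu>)"
    proof (rule summable_comparison_test'[where N = 0])
      show "summable (\<lambda>n. r n * K * measure \<nu> (space \<nu>))"
        by (intro summable_mult2 r)
      show "norm (\<integral>z. norm (F n z) \<partial>\<nu>) \<le> r n * K * measure \<nu> (space \<nu>)" for n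
        using le[of n] by simp
    qed
  qed
  also have "(\<lambda>n. \<integral>z. F n z \<partial>\<nu>) = (\<lambda>n. of_real (r n) * cinner (B (a n)) (b n))"
    by (simp add: F_def B(2) mult.assoc)
  also have "(\<lambda>z. \<Sum>n. F n z) = (\<lambda>z. cnj (op_conv R (adj (check S)) z) * h z)"
    using F_sums by (simp add: sums_unique[symmetric] fun_eq_iff)
  finally show ?thesis
    using op_trace_comp_adj[OF B(1) svd r] sums_unique2 by blast
qed

text \<open>
  Testing against the rank one operators \<open>v \<mapsto> \<langle>v, x\<rangle> y\<close> with unit vectors \<open>x\<close>, \<open>y\<close> recovers the matrix
  elements \<open>\<langle>B x, y\<rangle>\<close>, so traces against trace class operators determine a bounded operator.
\<close>

lemma bounded_op_eq_if_traces_eq: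
  fixes B B' :: "'a::euclidean_space op"
  assumes g: "orthonormal_seq (g :: nat \<Rightarrow> 'a l2)" and B: "bounded_op B" "bounded_op B'"
    and traces: "\<And>R. R \<in> schatten 1 \<Longrightarrow> op_trace (B \<circ> adj R) = op_trace (B' \<circ> adj R)"
  shows "B = B'"
proof -
  have unit: "cinner (B x) y = cinner (B' x) y" if xy: "norm x = 1" "norm y = 1" for x y
  proof -
    let ?r = "\<lambda>n::nat. if n = 0 then 1 else 0 :: real" and ?R = "\<lambda>v. scaleC (cinner v x) y"
    obtain a b where ab: "a 0 = x" "b 0 = y" and svd: "singular_value_decomp ?R ?r a b"
      using rank_one_singular_value_decomp[OF g xy] .
    have r: "summable ?r"
      by (rule summable_finite[of "{0}"]) auto
    have "(\<lambda>n. ?r n powr 1) = ?r"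
      by auto
    then have "summable (\<lambda>n. ?r n powr 1)"
      using r by (simp only:)
    with svd have R: "?R \<in> schatten 1"
      unfolding schatten_def by (intro CollectI exI conjI)
    have "op_trace (T \<circ> adj ?R) = cinner (T x) y" if "bounded_op T" for T
    proof (rule sums_unique2[OF op_trace_comp_adj[OF that svd r]])
      show "(\<lambda>n. of_real (?r n) * cinner (T (a n)) (b n)) sums cinner (T x) y"
        using sums_finite[of "{0}" "\<lambda>n. of_real (?r n) * cinner (T (a n)) (b n)"]
        by (simp add: ab)
    qed
    with traces[OF R] B show ?thesis
      by simp
  qed
  have scaled: "x = scaleC (of_real (norm x)) (x /\<^sub>R norm x)" "norm (x /\<^sub>R norm x) = 1"
    if "x \<noteq> 0" for x :: "'a l2"
    using that by (simp_all flip: scaleR_l2_def)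
  have lin: "T (scaleC c x) = scaleC c (T x)" "T 0 = 0" if "bounded_op T" for T c x
    using that by (auto simp: bounded_op_def linear_0 bounded_linear.linear)
  have "cinner (B x) y = cinner (B' x) y" for x y
  proof (cases "x = 0 \<or> y = 0")
    case True
    then show ?thesis
      using lin(2)[OF B(1)] lin(2)[OF B(2)] by auto
  next
    case False
    then have "cinner (T x) y
        = of_real (norm x) * (of_real (norm y) * cinner (T (x /\<^sub>R norm x)) (y /\<^sub>R norm y))"
      if "bounded_op T" for T
      using scaled(1)[of x] scaled(1)[of y] lin(1)[OF that]
      by (metis cinner_scaleC_left cinner_scaleC_right complex_cnj_complex_of_real mult.left_commute)
    with B False show ?thesis
      by (simp add: unit scaled(2))
  qed
  then show ?thesis
    by (intro ext cinner_eqI)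
qed

text \<open>
  The right singular vectors of \<open>S\<close> serve a second purpose: they are an infinite orthonormal sequence,
  which witnesses that the space is infinite-dimensional, so that rank one test operators have
  singular value decompositions.
\<close>

theorem corollary3p5:
  fixes S :: "(real ^ 'd) op"
    and \<mu> :: "((real ^ 'd) \<times> (real ^ 'd)) set \<Rightarrow> complex"
    and p :: real
  assumes "1 \<le> p"
    and "S \<in> schatten p"
    and "complex_measure \<mu>"
  shows "\<forall>\<psi> \<phi>. cinner (measure_conv \<mu> S \<psi>) \<phi> =
    cm_integral \<mu> (\<lambda>z. cinner ((tf_shift z \<circ> S \<circ> adj (tf_shift z)) \<psi>) \<phi>)"
proof -
  obtain s e f where S: "singular_value_decomp S s e f"
    using assms(2) by (auto simp: schatten_def)
  then have e: "orthonormal_seq e"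
    by (simp add: singular_value_decomp_def)
  obtain \<nu> h where \<mu>: "polar_decomp \<mu> \<nu> h" and cm: "\<And>F. cm_integral \<mu> F = (\<integral>z. F z * h z \<partial>\<nu>)"
    by (rule cm_integral_polar[OF assms(3)]) (rule that)
  obtain B where B: "bounded_op B"
    "\<And>\<psi> \<phi>. cinner (B \<psi>) \<phi> = (\<integral>z. cinner (shift_op z S \<psi>) \<phi> * h z \<partial>\<nu>)"
    by (rule weak_integral_shift_op[OF S \<mu>]) (rule that)
  have traces: "op_trace (B \<circ> adj R) = cm_integral \<mu> (\<lambda>z. cnj (op_conv R (adj (check S)) z))"
    if "R \<in> schatten 1" for R
    unfolding cm by (rule op_trace_comp_adj_weak_integral[OF S \<mu> B that])
  have "measure_conv \<mu> S = B"
    unfolding measure_conv_def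
  proof (rule the_equality)
    fix B' assume B': "bounded_op B' \<and> (\<forall>R\<in>schatten 1. op_trace (B' \<circ> adj R) =
        cm_integral \<mu> (\<lambda>z. cnj (op_conv R (adj (check S)) z)))"
    show "B' = B"
      by (rule bounded_op_eq_if_traces_eq[OF e]) (use B' B(1) traces in auto)
  qed (use B(1) traces in blast)
  then show ?thesis
    by (simp only: B(2) cm) simp
qed

end
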